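(* Let $(V_1,V_2)$ be a pair of commuting isometries on a Hilbert space $\mathcal H$ such that $C(V_1,V_2)\le 0$ and $C(V_1,V_2)\neq0$, and let $V=V_1V_2$. Then there is a non-trivial (nonzero) closed subspace $\mathcal L\subsetneq\ker V^*$ such that, up to unitary equivalence, $\mathcal H=\mathcal H_0\oplus\mathcal H_0^\perp$ with $\mathcal H_0=H^2_{\mathbb D^2}\otimes\mathcal L$, and in this decomposition $$V_i=\begin{pmatrix}\tau_i\otimes I_{\mathcal L}&0\\0&V_i|_{\mathcal H_0^\perp}\end{pmatrix},\ i=1,2,\qquad C(V_1|_{\mathcal H_0^\perp},V_2|_{\mathcal H_0^\perp})=0,$$ where the dimension of $\mathcal L$ equals the dimension of the range of $C(V_1,V_2)$. Moreover, $\sigma(V_1,V_2)=\overline{\mathbb D^2}$, and for every point $(\lambda_1,\lambda_2)\in\mathbb D^2$ the non-singularity of the Koszul complex of $(V_1-\lambda_1I,V_2-\lambda_2I)$ breaks at stage 2.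
   Context: Defect operator: $C(V_1,V_2)=I-V_1V_1^*-V_2V_2^*+V_1V_2V_2^*V_1^*$. $H^2_{\mathbb D^2}$ is the Hardy space of the bidisc with orthonormal basis $\{z_1^{m_1}z_2^{m_2}\}_{m_1,m_2\ge0}$; $M_{z_1},M_{z_2}$ are the coordinate multiplication operators. Let $U$ be the unitary on $H^2_{\mathbb D^2}$ given by $U(z_1^{m_1}z_2^{m_2})=z_1^{m_1+2}z_2^{m_2}$ if $m_1\ge m_2$, $=z_1^{m_1+1}z_2^{m_2-1}$ if $m_1+1=m_2$, $=z_1^{m_1}z_2^{m_2-2}$ if $m_1+2\le m_2$. Define $\tau_1=U^*M_{z_1}$, $\tau_2=M_{z_2}U$ (a pair of commuting isometries). For commuting bounded operators $T_1,T_2$ on $\mathcal H$, the Koszul complex is $0\xrightarrow{\delta_0}\mathcal H\xrightarrow{\delta_1}\mathcal H\oplus\mathcal H\xrightarrow{\delta_2}\mathcal H\xrightarrow{\delta_3}0$ with $\delta_1h=(T_1h,T_2h)$, $\delta_2(h_1,h_2)=T_1h_2-T_2h_1$; the Taylor joint spectrum $\sigma(T_1,T_2)$ is the set of $(\lambda_1,\lambda_2)\in\mathbb C^2$ for which the complex of $(T_1-\lambda_1I,T_2-\lambda_2I)$ is not exact. The non-singularity breaks at stage $n$ ($n=1,2,3$) if $\operatorname{ran}\delta_{n-1}\neq\ker\delta_n$. *)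

theory Defs
  imports "HOL-Analysis.Analysis"
begin

class chilbert_space = real_normed_vector + complete_space +
  fixes scaleC :: "complex \<Rightarrow> 'a \<Rightarrow> 'a" (infixr \<open>*\<^sub>C\<close> 75)
  fixes cinner :: "'a \<Rightarrow> 'a \<Rightarrow> complex"
  assumes scaleC_of_real: "scaleC (complex_of_real r) x = r *\<^sub>R x"
    and scaleC_add_left: "scaleC (a + b) x = scaleC a x + scaleC b x"
    and scaleC_add_right: "scaleC a (x + y) = scaleC a x + scaleC a y"
    and scaleC_scaleC: "scaleC a (scaleC b x) = scaleC (a * b) x"
    and scaleC_one: "scaleC 1 x = x"
    and cinner_conj: "cinner x y = cnj (cinner y x)"
    and cinner_add_left: "cinner (x + y) z = cinner x z + cinner y z"
    and cinner_scaleC_left: "cinner (scaleC a x) y = a * cinner x y"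
    and cinner_self_norm: "cinner x x = complex_of_real ((norm x)\<^sup>2)"

definition cblinear :: "('a::chilbert_space \<Rightarrow> 'a) \<Rightarrow> bool" where
  "cblinear T \<longleftrightarrow> (\<forall>x y. T (x + y) = T x + T y) \<and> (\<forall>a x. T (a *\<^sub>C x) = a *\<^sub>C T x)
     \<and> (\<exists>K. \<forall>x. norm (T x) \<le> K * norm x)"

definition is_adjoint :: "('a::chilbert_space \<Rightarrow> 'a) \<Rightarrow> ('a \<Rightarrow> 'a) \<Rightarrow> bool" where
  "is_adjoint T S \<longleftrightarrow> (\<forall>x y. cinner (T x) y = cinner x (S y))"

definition adj :: "('a::chilbert_space \<Rightarrow> 'a) \<Rightarrow> ('a \<Rightarrow> 'a)" where
  "adj T = (SOME S. is_adjoint T S)"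

definition isometry :: "('a::chilbert_space \<Rightarrow> 'a) \<Rightarrow> bool" where
  "isometry V \<longleftrightarrow> cblinear V \<and> (\<forall>x. norm (V x) = norm x)"

definition defect :: "('a::chilbert_space \<Rightarrow> 'a) \<Rightarrow> ('a \<Rightarrow> 'a) \<Rightarrow> 'a \<Rightarrow> 'a" where
  "defect V1 V2 x = x - V1 (adj V1 x) - V2 (adj V2 x) + V1 (V2 (adj V2 (adj V1 x)))"

definition csubspace :: "'a::chilbert_space set \<Rightarrow> bool" where
  "csubspace S \<longleftrightarrow> 0 \<in> S \<and> (\<forall>x\<in>S. \<forall>y\<in>S. x + y \<in> S) \<and> (\<forall>a. \<forall>x\<in>S. a *\<^sub>C x \<in> S)"

definition closed_csubspace :: "'a::chilbert_space set \<Rightarrow> bool" where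
  "closed_csubspace S \<longleftrightarrow> csubspace S \<and> closed S"

definition orth :: "'a::chilbert_space set \<Rightarrow> 'a set" where
  "orth S = {y. \<forall>x\<in>S. cinner x y = 0}"

definition cspan :: "'a::chilbert_space set \<Rightarrow> 'a set" where
  "cspan E = {x. \<exists>F c. finite F \<and> F \<subseteq> E \<and> x = (\<Sum>e\<in>F. c e *\<^sub>C e)}"

definition orthonormal_basis_of :: "'a::chilbert_space set \<Rightarrow> 'a set \<Rightarrow> bool" where
  "orthonormal_basis_of E S \<longleftrightarrow> E \<subseteq> S \<and> (\<forall>e\<in>E. norm e = 1)
     \<and> (\<forall>e\<in>E. \<forall>f\<in>E. e \<noteq> f \<longrightarrow> cinner e f = 0) \<and> closure (cspan E) = S"

definition same_hilbert_dim :: "'a::chilbert_space set \<Rightarrow> 'a set \<Rightarrow> bool" where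
  "same_hilbert_dim A B \<longleftrightarrow>
     (\<exists>E F. orthonormal_basis_of E A \<and> orthonormal_basis_of F B \<and> (\<exists>g. bij_betw g E F))"

definition adj_on :: "'a::chilbert_space set \<Rightarrow> ('a \<Rightarrow> 'a) \<Rightarrow> ('a \<Rightarrow> 'a)" where
  "adj_on S T = (SOME A. (\<forall>y\<in>S. A y \<in> S) \<and> (\<forall>x\<in>S. \<forall>y\<in>S. cinner (T x) y = cinner x (A y)))"

definition defect_on :: "'a::chilbert_space set \<Rightarrow> ('a \<Rightarrow> 'a) \<Rightarrow> ('a \<Rightarrow> 'a) \<Rightarrow> 'a \<Rightarrow> 'a" where
  "defect_on S V1 V2 x = x - V1 (adj_on S V1 x) - V2 (adj_on S V2 x)
      + V1 (V2 (adj_on S V2 (adj_on S V1 x)))"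

section \<open>H^2(D^2) \<otimes> L as L-valued square summable coefficient families\<close>

text \<open>An element of \<open>H^2_{D^2} \<otimes> L\<close> is written \<open>\<Sum>_m z^m \<otimes> c m\<close> with \<open>c : \<nat>\<^sup>2 \<Rightarrow> L\<close>.\<close>
definition l2L :: "'a::chilbert_space set \<Rightarrow> (nat \<times> nat \<Rightarrow> 'a) set" where
  "l2L L = {c. (\<forall>m. c m \<in> L) \<and> (\<lambda>m. (norm (c m))\<^sup>2) summable_on UNIV}"

definition l2_normsq :: "(nat \<times> nat \<Rightarrow> 'a::chilbert_space) \<Rightarrow> real" where
  "l2_normsq c = infsum (\<lambda>m. (norm (c m))\<^sup>2) UNIV"

text \<open>Index map of U: \<open>U(z^m) = z^(Umap m)\<close>.\<close>
definition Umap :: "nat \<times> nat \<Rightarrow> nat \<times> nat" where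
  "Umap m = (case m of (m1, m2) \<Rightarrow>
     if m1 \<ge> m2 then (m1 + 2, m2)
     else if m1 + 1 = m2 then (m1 + 1, m2 - 1)
     else (m1, m2 - 2))"

definition U_op :: "(nat \<times> nat \<Rightarrow> 'a::chilbert_space) \<Rightarrow> (nat \<times> nat \<Rightarrow> 'a)" where
  "U_op c n = (if n \<in> range Umap then c (inv Umap n) else 0)"

definition Ustar_op :: "(nat \<times> nat \<Rightarrow> 'a::chilbert_space) \<Rightarrow> (nat \<times> nat \<Rightarrow> 'a)" where
  "Ustar_op c n = c (Umap n)"

definition Mz1_op :: "(nat \<times> nat \<Rightarrow> 'a::chilbert_space) \<Rightarrow> (nat \<times> nat \<Rightarrow> 'a)" where
  "Mz1_op c n = (case n of (n1, n2) \<Rightarrow> if n1 = 0 then 0 else c (n1 - 1, n2))"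

definition Mz2_op :: "(nat \<times> nat \<Rightarrow> 'a::chilbert_space) \<Rightarrow> (nat \<times> nat \<Rightarrow> 'a)" where
  "Mz2_op c n = (case n of (n1, n2) \<Rightarrow> if n2 = 0 then 0 else c (n1, n2 - 1))"

definition tau1_op :: "(nat \<times> nat \<Rightarrow> 'a::chilbert_space) \<Rightarrow> (nat \<times> nat \<Rightarrow> 'a)" where
  "tau1_op c = Ustar_op (Mz1_op c)"

definition tau2_op :: "(nat \<times> nat \<Rightarrow> 'a::chilbert_space) \<Rightarrow> (nat \<times> nat \<Rightarrow> 'a)" where
  "tau2_op c = Mz2_op (U_op c)"

text \<open>Non-singularity of the Koszul complex of (T1,T2) breaks at stage n:
  ran \<delta>_{n-1} \<noteq> ker \<delta>_n.\<close>
definition koszul_breaks_at :: "('a::chilbert_space \<Rightarrow> 'a) \<Rightarrow> ('a \<Rightarrow> 'a) \<Rightarrow> nat \<Rightarrow> bool" where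
  "koszul_breaks_at T1 T2 n \<longleftrightarrow>
     (n = 1 \<and> {0} \<noteq> {h. T1 h = 0 \<and> T2 h = 0}) \<or>
     (n = 2 \<and> {(T1 h, T2 h) | h. True} \<noteq> {(h1, h2). T1 h2 - T2 h1 = 0}) \<or>
     (n = 3 \<and> {T1 h2 - T2 h1 | h1 h2. True} \<noteq> UNIV)"

definition koszul_exact :: "('a::chilbert_space \<Rightarrow> 'a) \<Rightarrow> ('a \<Rightarrow> 'a) \<Rightarrow> bool" where
  "koszul_exact T1 T2 \<longleftrightarrow> (\<forall>n\<in>{1,2,3}. \<not> koszul_breaks_at T1 T2 n)"

definition taylor_spectrum :: "('a::chilbert_space \<Rightarrow> 'a) \<Rightarrow> ('a \<Rightarrow> 'a) \<Rightarrow> (complex \<times> complex) set" where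
  "taylor_spectrum T1 T2 =
     {(l1, l2). \<not> koszul_exact (\<lambda>x. T1 x - l1 *\<^sub>C x) (\<lambda>x. T2 x - l2 *\<^sub>C x)}"

end

theory Submission
  imports Defs
begin

text \<open>
  Write \<open>A\<^sub>i\<close> for the adjoint of \<open>V\<^sub>i\<close> and \<open>V = V\<^sub>1V\<^sub>2\<close>. Testing \<open>C(V\<^sub>1,V\<^sub>2) \<le> 0\<close> on \<open>ker A\<^sub>1\<close> gives
  \<open>ker A\<^sub>1 \<subseteq> ran V\<^sub>2\<close>, and by symmetry \<open>ker A\<^sub>2 \<subseteq> ran V\<^sub>1\<close>. Hence \<open>-C\<close> is the orthogonal projection
  onto \<open>E = ran V\<^sub>1 \<inter> ran V\<^sub>2 \<inter> ker (A\<^sub>1A\<^sub>2)\<close>. The positive powers of \<open>A\<^sub>1\<close> and of \<open>A\<^sub>2\<close> act isometrically on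
  \<open>E\<close> with values in \<open>ker A\<^sub>2\<close> and \<open>ker A\<^sub>1\<close> respectively, so the images of \<open>E\<close> under \<open>V\<^sup>k A\<^sub>1\<^sup>p\<close>
  (\<open>p \<ge> 1\<close>) and \<open>V\<^sup>k A\<^sub>2\<^sup>q\<close> (\<open>q \<ge> 0\<close>) are pairwise orthogonal copies of \<open>E\<close>, permuted by \<open>V\<^sub>1, V\<^sub>2\<close> in the
  same way as the \<open>\<tau>\<^sub>i\<close> permute monomials. They span a reducing subspace containing \<open>E\<close>, and the
  defect vanishes on its complement.

  For \<open>|\<lambda>\<^sub>1|, |\<lambda>\<^sub>2| < 1\<close> and \<open>0 \<noteq> e \<in> E\<close> one solves \<open>(V\<^sub>1 - \<lambda>\<^sub>1) h\<^sub>2 = e = (V\<^sub>2 - \<lambda>\<^sub>2) h\<^sub>1\<close> with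
  \<open>h\<^sub>2 \<in> ker A\<^sub>2\<close>; as \<open>ker A\<^sub>2\<close> meets \<open>ran (V\<^sub>2 - \<lambda>\<^sub>2)\<close> only in \<open>0\<close>, stage 2 breaks. As \<open>|\<lambda>\<^sub>1| \<rightarrow> 1\<close>
  the norm of \<open>h\<^sub>2\<close> blows up, which produces joint approximate eigenvectors of \<open>(A\<^sub>1, A\<^sub>2)\<close> and, by
  uniform boundedness, breaks stage 3 at the boundary points. Outside the closed bidisc one of the
  \<open>V\<^sub>i - \<lambda>\<^sub>i\<close> is invertible.
\<close>

section \<open>Hilbert space preliminaries\<close>

instance chilbert_space \<subseteq> banach ..

section \<open>Arithmetic of the inner product and of bounded operators\<close>

lemma scaleC_zero_left [simp]: "0 *\<^sub>C (x::'a::chilbert_space) = 0"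
  using scaleC_of_real[of 0 x] by simp

lemma scaleC_zero_right [simp]: "a *\<^sub>C (0::'a::chilbert_space) = 0"
  using scaleC_add_right[of a "0::'a" 0] by simp

lemma scaleC_minus_left: "(- a) *\<^sub>C (x::'a::chilbert_space) = - (a *\<^sub>C x)"
  using scaleC_add_left[of "-a" a x] by (simp add: eq_neg_iff_add_eq_0)

lemma scaleC_minus_right: "a *\<^sub>C (- (x::'a::chilbert_space)) = - (a *\<^sub>C x)"
  using scaleC_add_right[of a "-x" x] by (simp add: eq_neg_iff_add_eq_0)

lemma scaleC_diff_right: "a *\<^sub>C (x - y) = a *\<^sub>C x - a *\<^sub>C (y::'a::chilbert_space)"
  using scaleC_add_right[of a x "-y"] by (simp add: scaleC_minus_right)

lemma scaleR_scaleC: "r *\<^sub>R (x::'a::chilbert_space) = complex_of_real r *\<^sub>C x"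
  by (simp add: scaleC_of_real)

lemma cinner_add_right: "cinner x (y + z) = cinner x y + cinner (x::'a::chilbert_space) z"
  by (metis cinner_add_left cinner_conj complex_cnj_add)

lemma cinner_scaleC_right: "cinner x (a *\<^sub>C y) = cnj a * cinner (x::'a::chilbert_space) y"
  by (metis cinner_scaleC_left cinner_conj complex_cnj_mult)

lemma cinner_zero_left [simp]: "cinner 0 (x::'a::chilbert_space) = 0"
  using cinner_add_left[of "0::'a" 0 x] by simp

lemma cinner_zero_right [simp]: "cinner (x::'a::chilbert_space) 0 = 0"
  using cinner_add_right[of x 0 0] by simp

lemma cinner_minus_left: "cinner (- x) y = - cinner (x::'a::chilbert_space) y"
  using cinner_add_left[of "-x" x y] by (simp add: eq_neg_iff_add_eq_0)

lemma cinner_minus_right: "cinner x (- y) = - cinner (x::'a::chilbert_space) y"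
  using cinner_add_right[of x "-y" y] by (simp add: eq_neg_iff_add_eq_0)

lemma cinner_diff_left: "cinner (x - y) z = cinner x z - cinner (y::'a::chilbert_space) z"
  using cinner_add_left[of x "-y" z] by (simp add: cinner_minus_left)

lemma cinner_diff_right: "cinner x (y - z) = cinner x y - cinner (x::'a::chilbert_space) z"
  using cinner_add_right[of x y "-z"] by (simp add: cinner_minus_right)

lemma cinner_commute_zero: "cinner x y = 0 \<longleftrightarrow> cinner y (x::'a::chilbert_space) = 0"
  by (metis cinner_conj complex_cnj_zero)

lemma cinner_sum_right: "cinner y (sum f F) = (\<Sum>i\<in>F. cinner (y::'a::chilbert_space) (f i))"
  by (induction F rule: infinite_finite_induct) (auto simp: cinner_add_right)

lemma cinner_self_eq_0_iff: "cinner x x = 0 \<longleftrightarrow> (x::'a::chilbert_space) = 0"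
  by (simp add: cinner_self_norm)

lemma norm_sq_Re_cinner: "(norm (x::'a::chilbert_space))\<^sup>2 = Re (cinner x x)"
  by (simp add: cinner_self_norm)

lemma norm_add_sq:
  "(norm (x + y))\<^sup>2 = (norm x)\<^sup>2 + 2 * Re (cinner x y) + (norm (y::'a::chilbert_space))\<^sup>2"
proof -
  have "Re (cinner y x) = Re (cinner x y)"
    using cinner_conj[of x y] by simp
  then show ?thesis
    by (simp add: norm_sq_Re_cinner cinner_add_left cinner_add_right)
qed

lemma norm_diff_sq:
  "(norm (x - y))\<^sup>2 = (norm x)\<^sup>2 - 2 * Re (cinner x y) + (norm (y::'a::chilbert_space))\<^sup>2"
  using norm_add_sq[of x "-y"] by (simp add: cinner_minus_right)

lemma norm_add_sq_orth:
  "cinner x y = 0 \<Longrightarrow> (norm (x + y))\<^sup>2 = (norm x)\<^sup>2 + (norm (y::'a::chilbert_space))\<^sup>2"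
  by (simp add: norm_add_sq)

lemma norm_scaleC: "norm (a *\<^sub>C (x::'a::chilbert_space)) = cmod a * norm x"
proof -
  have "cinner (a *\<^sub>C x) (a *\<^sub>C x) = (a * cnj a) * cinner x x"
    by (simp add: cinner_scaleC_left cinner_scaleC_right)
  then have "complex_of_real ((norm (a *\<^sub>C x))\<^sup>2) = complex_of_real ((cmod a * norm x)\<^sup>2)"
    unfolding cinner_self_norm complex_norm_square[symmetric] by (simp add: power_mult_distrib)
  then have "(norm (a *\<^sub>C x))\<^sup>2 = (cmod a * norm x)\<^sup>2"
    using of_real_eq_iff by blast
  then show ?thesis
    by (simp add: power2_eq_iff_nonneg)
qed

text \<open>Pythagoras: the projection \<open>a *\<^sub>C y\<close> of \<open>x\<close> onto the
  line through \<open>y\<close> is no longer than \<open>x\<close>.\<close>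

lemma norm_cinner_le: "cmod (cinner x y) \<le> norm x * norm (y::'a::chilbert_space)"
proof (cases "y = 0")
  case False
  define a where "a = cinner x y / complex_of_real ((norm y)\<^sup>2)"
  have "cinner (x - a *\<^sub>C y) y = 0"
    using False by (simp add: cinner_diff_left cinner_scaleC_left a_def cinner_self_norm)
  then have "cinner (x - a *\<^sub>C y) (a *\<^sub>C y) = 0"
    by (simp add: cinner_scaleC_right)
  from norm_add_sq_orth[OF this] have "(norm (a *\<^sub>C y))\<^sup>2 \<le> (norm x)\<^sup>2"
    by simp
  then have "norm (a *\<^sub>C y) \<le> norm x"
    by (rule power2_le_imp_le) simp
  then have "cmod a * norm y \<le> norm x"
    by (simp only: norm_scaleC)
  moreover have "cmod a = cmod (cinner x y) / (norm y)\<^sup>2"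
    by (simp add: a_def norm_divide del: of_real_power)
  ultimately show ?thesis
    using False by (simp add: field_simps power2_eq_square)
qed simp

lemma bounded_linear_scaleC: "bounded_linear (\<lambda>x::'a::chilbert_space. a *\<^sub>C x)"
  by (rule bounded_linear_intro[where K = "cmod a"])
    (auto simp: scaleC_add_right scaleR_scaleC scaleC_scaleC mult.commute norm_scaleC)

lemma bounded_linear_cinner_left: "bounded_linear (\<lambda>x. cinner x (y::'a::chilbert_space))"
  by (rule bounded_linear_intro[where K = "norm y"])
    (auto simp: cinner_add_left cinner_scaleC_left scaleR_scaleC norm_cinner_le scaleR_conv_of_real)

lemma cblinear_imp_bounded_linear: "cblinear T \<Longrightarrow> bounded_linear T"
  unfolding cblinear_def
  by (metis bounded_linear_intro mult.commute scaleR_scaleC)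

lemma cblinear_diff: "cblinear T \<Longrightarrow> T (x - y) = T x - T y"
  using bounded_linear.linear cblinear_imp_bounded_linear linear_diff by blast

lemma cblinear_zero: "cblinear T \<Longrightarrow> T 0 = 0"
  using bounded_linear.linear cblinear_imp_bounded_linear linear_0 by blast

lemma cblinear_minus: "cblinear T \<Longrightarrow> T (- x) = - T x"
  using bounded_linear.linear cblinear_imp_bounded_linear linear_neg by blast

lemma cblinear_add: "cblinear T \<Longrightarrow> T (x + y) = T x + T y"
  by (simp add: cblinear_def)

lemma cblinear_scaleC: "cblinear T \<Longrightarrow> T (a *\<^sub>C x) = a *\<^sub>C T x"
  by (simp add: cblinear_def)

lemma cblinear_compose:
  assumes "cblinear S" "cblinear T"
  shows "cblinear (\<lambda>x. S (T x))"
proof -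
  have "bounded_linear (\<lambda>x. S (T x))"
    using assms bounded_linear_compose cblinear_imp_bounded_linear by blast
  then show ?thesis
    using assms unfolding cblinear_def
    by (metis bounded_linear.bounded mult.commute)
qed

lemma cblinear_id: "cblinear (\<lambda>x. x)"
  unfolding cblinear_def by (auto intro: exI[of _ 1])

lemma cblinear_funpow: "cblinear T \<Longrightarrow> cblinear (T ^^ n)"
  by (induction n) (simp_all add: cblinear_id[unfolded id_def[symmetric]] cblinear_compose comp_def cblinear_id id_def)

lemma csubspace_diff: "csubspace S \<Longrightarrow> x \<in> S \<Longrightarrow> y \<in> S \<Longrightarrow> x - y \<in> S"
  unfolding csubspace_def
  by (metis add_uminus_conv_diff scaleC_minus_left scaleC_one)

lemma csubspace_sum: "csubspace S \<Longrightarrow> (\<And>i. i \<in> F \<Longrightarrow> f i \<in> S) \<Longrightarrow> sum f F \<in> S"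
  by (induction F rule: infinite_finite_induct) (auto simp: csubspace_def)

lemma csubspace_scaleC: "csubspace S \<Longrightarrow> x \<in> S \<Longrightarrow> a *\<^sub>C x \<in> S"
  by (simp add: csubspace_def)

lemma csubspace_add: "csubspace S \<Longrightarrow> x \<in> S \<Longrightarrow> y \<in> S \<Longrightarrow> x + y \<in> S"
  by (simp add: csubspace_def)

lemma csubspace_closure:
  fixes S :: "'a::chilbert_space set"
  assumes S: "csubspace S"
  shows "csubspace (closure S)"
  unfolding csubspace_def
proof (intro conjI ballI allI)
  show "0 \<in> closure S"
    using S closure_subset csubspace_def by blast
next
  fix x y assume "x \<in> closure S" "y \<in> closure S"
  then obtain f g where "\<forall>n. f n \<in> S" "f \<longlonglongrightarrow> x" "\<forall>n. g n \<in> S" "g \<longlonglongrightarrow> y"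
    unfolding closure_sequential by blast
  then show "x + y \<in> closure S"
    unfolding closure_sequential using S tendsto_add[of f x sequentially g y]
    by (intro exI[of _ "\<lambda>n. f n + g n"]) (auto simp: csubspace_def)
next
  fix a x assume "x \<in> closure S"
  then obtain f where "\<forall>n. f n \<in> S" "f \<longlonglongrightarrow> x"
    unfolding closure_sequential by blast
  then show "a *\<^sub>C x \<in> closure S"
    unfolding closure_sequential using S bounded_linear.tendsto[OF bounded_linear_scaleC]
    by (intro exI[of _ "\<lambda>n. a *\<^sub>C f n"]) (auto simp: csubspace_def)
qed

lemma orth_closure:
  fixes S :: "'a::chilbert_space set"
  assumes "\<And>s. s \<in> S \<Longrightarrow> cinner s y = 0" "x \<in> closure S"
  shows "cinner x y = 0"
proof -
  obtain f where f: "\<forall>n. f n \<in> S" "f \<longlonglongrightarrow> x"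
    using assms unfolding closure_sequential by blast
  have "(\<lambda>n. cinner (f n) y) \<longlonglongrightarrow> cinner x y"
    using bounded_linear.tendsto[OF bounded_linear_cinner_left f(2)] .
  moreover have "(\<lambda>n. cinner (f n) y) = (\<lambda>n. 0)"
    using f assms by auto
  ultimately show ?thesis
    by (simp add: LIMSEQ_const_iff)
qed

lemma closed_cblinear_eq:
  assumes "cblinear S" "cblinear T"
  shows "closed {x. S x = T x}"
  using assms by (intro closed_Collect_eq linear_continuous_on cblinear_imp_bounded_linear)

section \<open>Orthogonal projections and Riesz representation\<close>

text \<open>A point of \<open>S\<close> nearest to \<open>x\<close> exists by Cantor's nested set
  theorem: the sets \<open>K n\<close> of near-minimisers are closed and decreasing, and the
  parallelogram law shrinks their diameters. Minimality then makes the residual orthogonal to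
  \<open>S\<close>.\<close>

theorem orthogonal_projection_exists:
  fixes S :: "'a::chilbert_space set"
  assumes S: "closed_csubspace S"
  obtains p where "p \<in> S" "\<And>s. s \<in> S \<Longrightarrow> cinner (x - p) s = 0"
proof -
  have sub: "csubspace S" and cl: "closed S" and ne: "S \<noteq> {}"
    using S by (auto simp: closed_csubspace_def csubspace_def)
  define d where "d = infdist x S"
  have d0: "d \<ge> 0"
    by (simp add: d_def infdist_nonneg)
  have dle: "d \<le> norm (x - s)" if "s \<in> S" for s
    using infdist_le[OF that, of x] by (simp add: d_def dist_norm)
  \<comment> \<open>Parallelogram law for \<open>x - u\<close> and \<open>x - v\<close>: the
    midpoint \<open>?m\<close> lies in \<open>S\<close>, hence at distance at least \<open>d\<close>
    from \<open>x\<close>.\<close>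
  have par: "(norm (u - v))\<^sup>2 \<le> 2 * (norm (x - u))\<^sup>2 + 2 * (norm (x - v))\<^sup>2 - 4 * d\<^sup>2"
    if "u \<in> S" "v \<in> S" for u v
  proof -
    let ?m = "complex_of_real (1/2) *\<^sub>C (u + v)"
    have "?m \<in> S"
      using that sub by (simp add: csubspace_scaleC csubspace_add)
    then have "d\<^sup>2 \<le> (norm (x - ?m))\<^sup>2"
      using dle d0 by (simp add: power_mono)
    moreover have "(x - u) + (x - v) = 2 *\<^sub>R (x - ?m)"
      unfolding scaleR_scaleC[symmetric] by (simp add: algebra_simps scaleR_2)
    then have "(norm ((x - u) + (x - v)))\<^sup>2 = 4 * (norm (x - ?m))\<^sup>2"
      by (simp add: power_mult_distrib)
    moreover have "(norm ((x - u) - (x - v)))\<^sup>2 + (norm ((x - u) + (x - v)))\<^sup>2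
        = 2 * (norm (x - u))\<^sup>2 + 2 * (norm (x - v))\<^sup>2"
      unfolding norm_add_sq norm_diff_sq[of "x - u" "x - v"] by simp
    moreover have "norm ((x - u) - (x - v)) = norm (u - v)"
      by (simp add: norm_minus_commute)
    ultimately show ?thesis by simp
  qed
  define K where "K n = {s \<in> S. (norm (x - s))\<^sup>2 \<le> d\<^sup>2 + 1 / Suc n}" for n :: nat
  have "\<exists>a. \<forall>n. a \<in> K n"
  proof -
    have clK: "closed (K n)" for n
    proof -
      have "K n = S \<inter> {s. (norm (x - s))\<^sup>2 \<le> d\<^sup>2 + 1 / Suc n}"
        by (auto simp: K_def)
      then show ?thesis
        by (auto intro!: closed_Int cl closed_Collect_le continuous_intros)
    qed
    have neK: "K n \<noteq> {}" for n
    proof -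
      have "sqrt (d\<^sup>2 + 1 / Suc n) > d"
        using d0 by (intro real_less_rsqrt) auto
      then have "infdist x S < sqrt (d\<^sup>2 + 1 / Suc n)"
        by (simp add: d_def)
      then obtain s where "s \<in> S" "dist x s < sqrt (d\<^sup>2 + 1 / Suc n)"
        using ne cInf_lessD[of "dist x ` S"] by (auto simp: infdist_notempty)
      then have "(norm (x - s))\<^sup>2 \<le> d\<^sup>2 + 1 / Suc n"
        using power_mono[of "norm (x - s)" "sqrt (d\<^sup>2 + 1 / Suc n)" 2]
        by (simp add: dist_norm)
      then show ?thesis
        using \<open>s \<in> S\<close> by (auto simp: K_def)
    qed
    have dec: "K n \<subseteq> K m" if "m \<le> n" for m n
    proof -
      have "1 / real (Suc n) \<le> 1 / real (Suc m)"
        using that by (simp add: frac_le)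
      then show ?thesis
        by (force simp: K_def)
    qed
    have diam: "\<exists>n. \<forall>u\<in>K n. \<forall>v\<in>K n. dist u v < e" if e: "e > 0" for e :: real
    proof -
      obtain n where n: "1 / Suc n < e\<^sup>2 / 4"
        using e nat_approx_posE[of "e\<^sup>2 / 4"] by (metis divide_pos_pos zero_less_numeral zero_less_power)
      have "dist u v < e" if "u \<in> K n" "v \<in> K n" for u v
      proof -
        have "(norm (u - v))\<^sup>2 \<le> 4 * (1 / Suc n)"
          using par[of u v] that unfolding K_def by simp
        then have "(norm (u - v))\<^sup>2 < e\<^sup>2"
          using n by simp
        then show ?thesis
          using \<open>e > 0\<close> by (simp add: dist_norm power2_less_imp_less)
      qed
      then show ?thesis by blast
    qed
    show ?thesis
      using decreasing_closed_nest[of K, OF clK neK dec diam] by metis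
  qed
  then obtain p where p: "\<And>n. p \<in> K n" by blast
  have pS: "p \<in> S"
    using p by (auto simp: K_def)
  have "(norm (x - p))\<^sup>2 \<le> d\<^sup>2"
  proof (rule field_le_epsilon)
    fix e :: real assume "e > 0"
    then obtain n where "1 / Suc n < e"
      using nat_approx_posE by blast
    then show "(norm (x - p))\<^sup>2 \<le> d\<^sup>2 + e"
      using p[of n] by (simp add: K_def)
  qed
  then have min: "(norm (x - p))\<^sup>2 \<le> (norm (x - s))\<^sup>2" if "s \<in> S" for s
    using power_mono[OF dle[OF that] d0, of 2] by linarith
  have "cinner (x - p) s = 0" if s: "s \<in> S" for s
  proof (cases "s = 0")
    case False
    \<comment> \<open>\<open>a *\<^sub>C s\<close> is the component of the residual along
      \<open>s\<close>. Adding it to \<open>p\<close> lowers the squared distance by its squared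
      norm, so minimality makes it vanish.\<close>
    define a where "a = cinner (x - p) s / complex_of_real ((norm s)\<^sup>2)"
    have "cinner (x - (p + a *\<^sub>C s)) (a *\<^sub>C s) = 0"
      using False
      by (simp add: cinner_diff_left cinner_add_left cinner_scaleC_left cinner_scaleC_right a_def cinner_self_norm)
    from norm_add_sq_orth[OF this]
    have "(norm (x - p))\<^sup>2 = (norm (x - (p + a *\<^sub>C s)))\<^sup>2 + (norm (a *\<^sub>C s))\<^sup>2"
      by (simp add: algebra_simps)
    moreover have "p + a *\<^sub>C s \<in> S"
      using pS s sub by (simp add: csubspace_scaleC csubspace_add)
    ultimately have "(norm (a *\<^sub>C s))\<^sup>2 \<le> 0"
      using min[of "p + a *\<^sub>C s"] by linarith
    then have "a = 0"
      using False by (simp add: norm_scaleC)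
    then show ?thesis
      using False by (simp add: a_def)
  qed simp
  with pS show thesis
    using that by blast
qed

text \<open>The residual \<open>u\<close> of a vector off the kernel is orthogonal to the kernel,
  and \<open>x - (f x / f u) u\<close> always lies in the kernel; pairing it with \<open>u\<close>
  yields the formula. The coefficient carries a conjugate because \<open>cinner\<close> is
  conjugate-linear in its second argument.\<close>

theorem riesz_representation:
  fixes f :: "'a::chilbert_space \<Rightarrow> complex"
  assumes add: "\<And>x y. f (x + y) = f x + f y" and scale: "\<And>a x. f (a *\<^sub>C x) = a * f x"
    and bounded: "\<And>x. cmod (f x) \<le> K * norm x"
  obtains y where "\<And>x. f x = cinner x y"
proof (cases "\<forall>x. f x = 0")
  case True
  then show thesis
    using that[of 0] by simp
next
  case False
  then obtain z where z: "f z \<noteq> 0" by blast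
  let ?N = "{x. f x = 0}"
  have bl: "bounded_linear f"
    by (rule bounded_linear_intro[where K = K])
      (auto simp: add scale scaleR_scaleC scaleR_conv_of_real bounded mult.commute)
  then have "f 0 = 0"
    using bounded_linear.linear linear_0 by blast
  moreover have "closed ?N"
    by (intro closed_Collect_eq linear_continuous_on bl continuous_on_const)
  ultimately have "closed_csubspace ?N"
    by (simp add: closed_csubspace_def csubspace_def add scale)
  then obtain p where p: "f p = 0" "\<And>s. f s = 0 \<Longrightarrow> cinner (z - p) s = 0"
    by (rule orthogonal_projection_exists[of ?N z]) blast
  define u where "u = z - p"
  have "f z = f u + f p"
    by (simp add: u_def add[symmetric])
  with z p have fu: "f u \<noteq> 0" by simp
  with \<open>f 0 = 0\<close> have u0: "u \<noteq> 0" by auto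
  have "f x = cinner x ((cnj (f u) / complex_of_real ((norm u)\<^sup>2)) *\<^sub>C u)" for x
  proof -
    have "f (x + (- (f x / f u)) *\<^sub>C u) = 0"
      using fu by (simp only: add scale) (simp add: field_simps)
    then have "cinner u (x + (- (f x / f u)) *\<^sub>C u) = 0"
      using p u_def by blast
    then have "cinner (x + (- (f x / f u)) *\<^sub>C u) u = 0"
      using cinner_commute_zero by blast
    then have "cinner x u = f x / f u * complex_of_real ((norm u)\<^sup>2)"
      by (simp add: cinner_diff_left cinner_scaleC_left cinner_self_norm scaleC_minus_left)
    then show ?thesis
      using fu u0 by (simp add: cinner_scaleC_right)
  qed
  then show thesis
    using that by blast
qed

text \<open>\<open>adj\<close> is a choice, so a candidate has to be produced: Riesz applied to
  \<open>\<lambda>x. cinner (T x) y\<close> for each \<open>y\<close>.\<close>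

lemma is_adjoint_adj:
  assumes T: "cblinear T"
  shows "is_adjoint T (adj T)"
proof -
  obtain K where K: "\<And>x. norm (T x) \<le> K * norm x"
    using T cblinear_def by blast
  have "\<exists>z. \<forall>x. cinner (T x) y = cinner x z" for y
  proof -
    have "cmod (cinner (T x) y) \<le> (K * norm y) * norm x" for x
      using norm_cinner_le[of "T x" y] mult_right_mono[OF K[of x] norm_ge_zero[of y]]
      by (simp add: algebra_simps)
    then obtain z where "\<And>x. cinner (T x) y = cinner x z"
      using riesz_representation[of "\<lambda>x. cinner (T x) y" "K * norm y"] T
      by (auto simp: cblinear_def cinner_add_left cinner_scaleC_left)
    then show ?thesis by blast
  qed
  then have "\<exists>S. is_adjoint T S"
    unfolding is_adjoint_def by metis
  then show ?thesis
    unfolding adj_def by (rule someI_ex)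
qed

lemma cinner_adj_right: "cblinear T \<Longrightarrow> cinner x (adj T y) = cinner (T x) y"
  using is_adjoint_adj is_adjoint_def by metis

lemma cinner_adj_left: "cblinear T \<Longrightarrow> cinner (adj T x) y = cinner x (T y)"
  by (metis cinner_adj_right cinner_conj)

lemma cinner_ext: "(\<And>z. cinner z x = cinner z y) \<Longrightarrow> x = (y::'a::chilbert_space)"
  by (metis cinner_diff_right cinner_self_eq_0_iff right_minus_eq)

lemma cblinear_adj:
  assumes T: "cblinear T"
  shows "cblinear (adj T)"
proof -
  obtain K where K: "\<And>x. norm (T x) \<le> K * norm x"
    using T cblinear_def by blast
  have "norm (adj T x) \<le> K * norm x" for x
  proof (cases "adj T x = 0")
    case True
    then show ?thesis
      using order.trans[OF norm_ge_zero K[of x]] by simp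
  next
    case False
    have "(norm (adj T x))\<^sup>2 = cmod (cinner (adj T x) (adj T x))"
      by (simp add: cinner_self_norm norm_power)
    also have "\<dots> = cmod (cinner (T (adj T x)) x)"
      by (simp add: T cinner_adj_right)
    also have "\<dots> \<le> (K * norm (adj T x)) * norm x"
      using norm_cinner_le[of "T (adj T x)" x] mult_right_mono[OF K[of "adj T x"] norm_ge_zero[of x]]
      by linarith
    finally show ?thesis
      using False by (simp add: power2_eq_square algebra_simps)
  qed
  moreover have "adj T (x + y) = adj T x + adj T y" for x y
    by (rule cinner_ext) (simp add: T cinner_adj_right cinner_add_right)
  moreover have "adj T (a *\<^sub>C x) = a *\<^sub>C adj T x" for a x
    by (rule cinner_ext) (simp add: T cinner_adj_right cinner_scaleC_right)
  ultimately show ?thesis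
    unfolding cblinear_def by blast
qed

section \<open>Spans and orthonormal bases\<close>

lemma csubspace_cspan: "csubspace (cspan E)"
  unfolding csubspace_def
proof (intro conjI ballI allI)
  show "0 \<in> cspan E"
    unfolding cspan_def by (auto intro!: exI[of _ "{}"])
next
  fix x y assume "x \<in> cspan E" "y \<in> cspan E"
  then obtain F c G d where *: "finite F" "F \<subseteq> E" "x = (\<Sum>e\<in>F. c e *\<^sub>C e)"
      "finite G" "G \<subseteq> E" "y = (\<Sum>e\<in>G. d e *\<^sub>C e)"
    unfolding cspan_def by blast
  have "x = (\<Sum>e\<in>F \<union> G. (if e \<in> F then c e else 0) *\<^sub>C e)"
    unfolding * using * by (intro sum.mono_neutral_cong_left) auto
  moreover have "y = (\<Sum>e\<in>F \<union> G. (if e \<in> G then d e else 0) *\<^sub>C e)"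
    unfolding * using * by (intro sum.mono_neutral_cong_left) auto
  ultimately have "x + y = (\<Sum>e\<in>F \<union> G. ((if e \<in> F then c e else 0) + (if e \<in> G then d e else 0)) *\<^sub>C e)"
    by (simp add: scaleC_add_left sum.distrib)
  moreover have "finite (F \<union> G)" "F \<union> G \<subseteq> E"
    using * by auto
  ultimately show "x + y \<in> cspan E"
    unfolding cspan_def mem_Collect_eq by (intro exI conjI) assumption+
next
  fix a x assume "x \<in> cspan E"
  then obtain F c where *: "finite F" "F \<subseteq> E" "x = (\<Sum>e\<in>F. c e *\<^sub>C e)"
    unfolding cspan_def by blast
  have "a *\<^sub>C x = (\<Sum>e\<in>F. (a * c e) *\<^sub>C e)"
    unfolding *(3) linear_sum[OF bounded_linear.linear[OF bounded_linear_scaleC[of a]]]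
    by (simp add: scaleC_scaleC)
  with *(1,2) show "a *\<^sub>C x \<in> cspan E"
    unfolding cspan_def mem_Collect_eq by (intro exI conjI)
qed

lemma subset_cspan: "E \<subseteq> cspan E"
proof
  fix e assume "e \<in> E"
  then show "e \<in> cspan E"
    unfolding cspan_def
    by (auto intro!: exI[of _ "{e}"] exI[of _ "\<lambda>_. 1"] simp: scaleC_one)
qed

text \<open>Zorn gives a maximal orthonormal subset \<open>M\<close> of \<open>S\<close>. If the
  closed span of \<open>M\<close> missed a vector of \<open>S\<close>, its normalised residual could
  be added to \<open>M\<close>.\<close>

theorem orthonormal_basis_exists:
  fixes S :: "'a::chilbert_space set"
  assumes S: "closed_csubspace S"
  obtains E where "orthonormal_basis_of E S"
proof -
  define P where "P E \<longleftrightarrow> E \<subseteq> S \<and> (\<forall>e\<in>E. norm e = 1) \<and> (\<forall>e\<in>E. \<forall>f\<in>E. e \<noteq> f \<longrightarrow> cinner e f = 0)" for E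
  have "\<exists>M\<in>Collect P. \<forall>X\<in>Collect P. M \<subseteq> X \<longrightarrow> X = M"
  proof (rule subset_Zorn')
    fix C assume C: "subset.chain (Collect P) C"
    then have CP: "\<And>E. E \<in> C \<Longrightarrow> P E"
      unfolding subset.chain_def by blast
    have "cinner e f = 0" if ef: "e \<in> \<Union>C" "f \<in> \<Union>C" "e \<noteq> f" for e f
    proof -
      obtain X Y where XY: "X \<in> C" "e \<in> X" "Y \<in> C" "f \<in> Y"
        using ef by blast
      then have "X \<subseteq> Y \<or> Y \<subseteq> X"
        using C unfolding subset_chain_def by blast
      then obtain Z where "Z \<in> C" "e \<in> Z" "f \<in> Z"
        using XY by blast
      then show ?thesis
        using CP[of Z] ef unfolding P_def by blast
    qed
    moreover have "\<forall>e\<in>\<Union>C. e \<in> S \<and> norm e = 1"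
      using CP unfolding P_def by (meson UnionE subsetD)
    ultimately show "\<Union>C \<in> Collect P"
      unfolding P_def by (simp add: subset_iff) blast
  qed
  then obtain M where PM: "P M" and max: "\<And>X. P X \<Longrightarrow> M \<subseteq> X \<Longrightarrow> X = M"
    by blast
  have sub: "csubspace S" and cl: "closed S"
    using S by (auto simp: closed_csubspace_def)
  have "cspan M \<subseteq> S"
  proof
    fix x assume "x \<in> cspan M"
    then obtain F c where "F \<subseteq> M" "x = (\<Sum>e\<in>F. c e *\<^sub>C e)"
      unfolding cspan_def by blast
    moreover have "M \<subseteq> S"
      using PM by (simp add: P_def)
    ultimately show "x \<in> S"
      using sub by (auto intro!: csubspace_sum csubspace_scaleC)
  qed
  then have le: "closure (cspan M) \<subseteq> S"
    by (simp add: cl closure_minimal)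
  have "x \<in> closure (cspan M)" if x: "x \<in> S" for x
  proof (rule ccontr)
    assume nx: "x \<notin> closure (cspan M)"
    have "closed_csubspace (closure (cspan M))"
      by (simp add: closed_csubspace_def csubspace_closure csubspace_cspan)
    then obtain p where p: "p \<in> closure (cspan M)" "\<And>s. s \<in> closure (cspan M) \<Longrightarrow> cinner (x - p) s = 0"
      using orthogonal_projection_exists by blast
    define u where "u = x - p"
    have u0: "u \<noteq> 0"
      using nx p u_def by auto
    have uS: "u \<in> S"
      unfolding u_def using x p le sub by (auto intro: csubspace_diff)
    define v where "v = complex_of_real (1 / norm u) *\<^sub>C u"
    have v1: "norm v = 1"
      using u0 by (simp add: v_def norm_scaleC norm_divide)
    have "M \<subseteq> closure (cspan M)"
      using subset_cspan closure_subset by blast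
    then have vo: "cinner v e = 0" if "e \<in> M" for e
      unfolding v_def cinner_scaleC_left u_def using p(2)[of e] that by auto
    have vo': "cinner e v = 0" if "e \<in> M" for e
      using vo[OF that] cinner_commute_zero by blast
    have "v \<in> S"
      unfolding v_def using uS sub by (simp add: csubspace_scaleC)
    then have "P (insert v M)"
      using PM v1 vo vo' by (simp add: P_def)
    then have "v \<in> M"
      using max by blast
    then have "cinner v v = 0"
      using vo by blast
    with v1 show False
      by (simp add: cinner_self_norm)
  qed
  with le have "closure (cspan M) = S" by blast
  with PM have "orthonormal_basis_of M S"
    unfolding orthonormal_basis_of_def P_def by blast
  then show thesis
    using that by blast
qed

text \<open>Sokal's gliding hump: of the two points \<open>x \<plusminus> w\<close> one satisfies
  \<open>|\<langle>x \<plusminus> w, u\<rangle>| \<ge> |\<langle>w, u\<rangle>|\<close>.\<close>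
theorem weakly_bounded_imp_bounded:
  fixes u :: "nat \<Rightarrow> 'a::chilbert_space"
  assumes weak: "\<And>z. \<exists>K. \<forall>n. cmod (cinner z (u n)) \<le> K"
  shows "\<exists>M. \<forall>n. norm (u n) \<le> M"
proof (rule ccontr)
  assume "\<not> ?thesis"
  then have "\<forall>k. \<exists>n. norm (u n) > 4 ^ k"
    using not_le by blast
  then obtain s where s: "\<And>k. norm (u (s k)) > 4 ^ k"
    by metis
  define v where "v k = u (s k)" for k
  have v: "norm (v k) > 4 ^ k" and v0: "v k \<noteq> 0" for k
    using s[of k] unfolding v_def by (auto intro: order.strict_trans[rotated])
  have "\<exists>z. \<forall>k. norm (z (Suc k) - z k) \<le> (1/3) ^ k
      \<and> cmod (cinner (z (Suc k)) (v k)) \<ge> (1/3) ^ k * norm (v k)"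
  proof -
    have "\<exists>y. norm (y - x) \<le> (1/3) ^ k \<and> cmod (cinner y (v k)) \<ge> (1/3) ^ k * norm (v k)" for k x
    proof -
      define w where "w = complex_of_real ((1/3) ^ k / norm (v k)) *\<^sub>C v k"
      have nw: "norm w = (1/3) ^ k"
        using v0[of k] unfolding w_def norm_scaleC norm_of_real by simp
      have "cinner w (v k) = complex_of_real ((1/3) ^ k * norm (v k))"
        using v0[of k] by (simp add: w_def cinner_scaleC_left cinner_self_norm power2_eq_square)
      then have iw: "cmod (cinner w (v k)) = (1/3) ^ k * norm (v k)"
        by (simp only: norm_of_real) simp
      have "2 * cinner w (v k) = cinner (x + w) (v k) - cinner (x - w) (v k)"
        by (simp add: cinner_add_left cinner_diff_left)
      then have "2 * cmod (cinner w (v k)) \<le> cmod (cinner (x + w) (v k)) + cmod (cinner (x - w) (v k))"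
        by (metis norm_mult norm_numeral norm_triangle_ineq4)
      then consider "cmod (cinner (x + w) (v k)) \<ge> cmod (cinner w (v k))"
        | "cmod (cinner (x - w) (v k)) \<ge> cmod (cinner w (v k))"
        by linarith
      then show ?thesis
        using nw iw by cases (auto intro: exI[of _ "x + w"] exI[of _ "x - w"])
    qed
    then have "\<forall>k x. \<exists>y. norm (y - x) \<le> (1/3) ^ k \<and> cmod (cinner y (v k)) \<ge> (1/3) ^ k * norm (v k)"
      by blast
    then obtain g where g: "\<forall>k x. norm (g k x - x) \<le> (1/3) ^ k \<and> cmod (cinner (g k x) (v k)) \<ge> (1/3) ^ k * norm (v k)"
      unfolding choice_iff by blast
    show ?thesis
      by (rule exI[of _ "rec_nat 0 g"]) (simp add: g)
  qed
  then obtain z where zd: "\<And>k. norm (z (Suc k) - z k) \<le> (1/3) ^ k"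
    and zi: "\<And>k. cmod (cinner (z (Suc k)) (v k)) \<ge> (1/3) ^ k * norm (v k)"
    by blast
  \<comment> \<open>Geometric series with its exact remainder subtracted, which is what lets the
    induction close.\<close>
  have tail: "norm (z (k + n) - z k) \<le> (3/2) * (1/3) ^ k - (3/2) * (1/3) ^ (k + n)" for k n
  proof (induction n)
    case (Suc n)
    have "norm (z (k + Suc n) - z k) \<le> norm (z (Suc (k + n)) - z (k + n)) + norm (z (k + n) - z k)"
      using norm_triangle_ineq[of "z (Suc (k + n)) - z (k + n)" "z (k + n) - z k"] by simp
    then show ?case
      using Suc zd[of "k + n"] by simp
  qed simp
  have tail': "norm (z m - z k) \<le> (3/2) * (1/3) ^ k" if "m \<ge> k" for m k
  proof -
    have "norm (z m - z k) \<le> (3/2) * (1/3) ^ k - (3/2) * (1/3) ^ m"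
      using tail[of k "m - k"] that by simp
    moreover have "(3/2) * (1/3::real) ^ m \<ge> 0"
      by simp
    ultimately show ?thesis by linarith
  qed
  have "Cauchy z"
  proof (rule metric_CauchyI)
    fix e :: real assume "e > 0"
    then obtain N where N: "(1/3::real) ^ N < e / 3"
      using real_arch_pow_inv[of "e/3" "1/3"] by auto
    have "dist (z m) (z n) < e" if "m \<ge> N" "n \<ge> N" for m n
      using tail'[OF that(1)] tail'[OF that(2)] N dist_triangle2[of "z m" "z n" "z N"]
      by (simp add: dist_norm)
    then show "\<exists>M. \<forall>m\<ge>M. \<forall>n\<ge>M. dist (z m) (z n) < e" by blast
  qed
  then obtain y where y: "z \<longlonglongrightarrow> y"
    using Cauchy_convergent_iff convergent_def by blast
  have ty: "norm (y - z k) \<le> (3/2) * (1/3) ^ k" for k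
  proof (rule LIMSEQ_le_const2)
    show "(\<lambda>n. norm (z n - z k)) \<longlonglongrightarrow> norm (y - z k)"
      using y by (intro tendsto_intros)
    show "\<exists>N. \<forall>n\<ge>N. norm (z n - z k) \<le> (3/2) * (1/3) ^ k"
      using tail' by blast
  qed
  obtain K where K: "\<And>n. cmod (cinner y (u n)) \<le> K"
    using weak by blast
  \<comment> \<open>All moves after \<open>z (Suc k)\<close> amount to at most
    \<open>(1/2) * (1/3) ^ k\<close>, so half of the pairing gained with \<open>v k\<close> survives
    in the limit \<open>y\<close>; the growth \<open>4 ^ k\<close> of \<open>norm (v k)\<close>
    outweighs \<open>(1/3) ^ k\<close>.\<close>
  have "(4/3) ^ k / 2 \<le> K" for k
  proof -
    have "cmod (cinner (y - z (Suc k)) (v k)) \<le> (1/2) * (1/3) ^ k * norm (v k)"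
      using order.trans[OF norm_cinner_le mult_right_mono[OF ty[of "Suc k"] norm_ge_zero[of "v k"]]]
      by simp
    moreover have "cmod (cinner (z (Suc k)) (v k)) \<le> cmod (cinner y (v k)) + cmod (cinner (y - z (Suc k)) (v k))"
      using norm_triangle_ineq4[of "cinner y (v k)" "cinner (y - z (Suc k)) (v k)"]
      by (simp add: cinner_diff_left)
    ultimately have "(1/2) * (1/3) ^ k * norm (v k) \<le> K"
      using zi[of k] K[of "s k"] unfolding v_def by linarith
    moreover have "(1/2) * (1/3) ^ k * 4 ^ k \<le> (1/2) * (1/3) ^ k * norm (v k)"
      using v[of k] by (intro mult_left_mono) auto
    moreover have "(4/3::real) ^ k / 2 = (1/2) * (1/3) ^ k * 4 ^ k"
      by (simp add: power_divide)
    ultimately show ?thesis by linarith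
  qed
  moreover obtain k where "2 * K < (4/3::real) ^ k"
    using real_arch_pow[of "4/3" "2 * K"] by auto
  ultimately show False
    by (smt (verit) field_sum_of_halves)
qed

section \<open>Isometries and their adjoints\<close>

lemma cinner_eqI: "Re (cinner x y) = Re (cinner u v) \<Longrightarrow>
    Re (cinner (\<i> *\<^sub>C x) y) = Re (cinner (\<i> *\<^sub>C u) v) \<Longrightarrow> cinner x y = cinner (u::'a::chilbert_space) v"
  by (simp add: cinner_scaleC_left complex_eq_iff)

lemma isometry_cblinear: "isometry V \<Longrightarrow> cblinear V"
  by (simp add: isometry_def)

lemma isometry_norm: "isometry V \<Longrightarrow> norm (V x) = norm x"
  by (simp add: isometry_def)

lemma isometry_compose: "isometry S \<Longrightarrow> isometry T \<Longrightarrow> isometry (\<lambda>x. S (T x))"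
  by (simp add: isometry_def cblinear_compose)

text \<open>Polarisation: norms of sums determine real parts, and multiplying by \<open>\<i>\<close>
  gives imaginary parts. The subspace form serves the cells, whose isometry is established on the
  core.\<close>

lemma cinner_preserved_on_subspace:
  assumes T: "cblinear T" and S: "csubspace S" and norm: "\<And>x. x \<in> S \<Longrightarrow> norm (T x) = norm x"
    and x: "x \<in> S" and y: "y \<in> S"
  shows "cinner (T x) (T y) = cinner x y"
proof -
  have re: "Re (cinner (T x) (T y)) = Re (cinner x y)" if "x \<in> S" "y \<in> S" for x y
  proof -
    have "norm (T x + T y) = norm (x + y)"
      using norm[of "x + y"] S that by (simp add: csubspace_add cblinear_add[OF T])
    then show ?thesis
      using norm_add_sq[of "T x" "T y"] norm_add_sq[of x y] norm that by simp
  qed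
  show ?thesis
    by (rule cinner_eqI) (simp_all add: re x y S csubspace_scaleC flip: cblinear_scaleC[OF T])
qed

lemma isometry_cinner: "isometry V \<Longrightarrow> cinner (V x) (V y) = cinner x y"
  by (rule cinner_preserved_on_subspace[where S = UNIV])
    (simp_all add: isometry_cblinear isometry_norm csubspace_def)

lemma adj_eqI:
  assumes "cblinear T" "\<And>z. cinner (T z) x = cinner z y"
  shows "adj T x = y"
  by (rule cinner_ext) (simp add: assms cinner_adj_right)

lemma adj_isometry: "isometry V \<Longrightarrow> adj V (V x) = x"
  by (simp add: adj_eqI isometry_cblinear isometry_cinner)

lemma adj_compose:
  assumes "cblinear S" "cblinear T"
  shows "adj (\<lambda>x. S (T x)) y = adj T (adj S y)"
  using assms by (intro adj_eqI) (simp_all add: cblinear_compose cinner_adj_right)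

lemma cblinear_minus_scaleC:
  assumes "cblinear T"
  shows "cblinear (\<lambda>x. T x - l *\<^sub>C x)"
proof -
  have "bounded_linear (\<lambda>x. T x - l *\<^sub>C x)"
    by (intro bounded_linear_sub cblinear_imp_bounded_linear[OF assms] bounded_linear_scaleC)
  then obtain K where "\<And>x. norm (T x - l *\<^sub>C x) \<le> norm x * K"
    using bounded_linear.bounded by blast
  then show ?thesis
    unfolding cblinear_def
    by (auto simp: cblinear_add[OF assms] cblinear_scaleC[OF assms] scaleC_add_right scaleC_diff_right
        scaleC_scaleC mult.commute)
qed

lemma adj_minus_scaleC:
  assumes "cblinear T"
  shows "adj (\<lambda>x. T x - l *\<^sub>C x) y = adj T y - cnj l *\<^sub>C y"
  by (rule adj_eqI)
    (simp_all add: assms cblinear_minus_scaleC cinner_diff_left cinner_diff_right cinner_adj_right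
      cinner_scaleC_left cinner_scaleC_right)

lemma norm_adj_isometry_le:
  assumes V: "isometry V"
  shows "norm (adj V x) \<le> norm x"
proof (cases "adj V x = 0")
  case False
  have "(norm (adj V x))\<^sup>2 = Re (cinner (V (adj V x)) x)"
    by (simp add: norm_sq_Re_cinner cinner_adj_right V isometry_cblinear)
  also have "\<dots> \<le> norm (adj V x) * norm x"
    using complex_Re_le_cmod[of "cinner (V (adj V x)) x"] norm_cinner_le[of "V (adj V x)" x]
    by (simp add: V isometry_norm)
  finally show ?thesis
    using False by (simp add: power2_eq_square)
qed simp

text \<open>\<open>V (adj V x)\<close> is the orthogonal projection onto \<open>ran V\<close>; thus
  \<open>norm (adj V x) = norm x\<close> detects membership in the range.\<close>

lemma norm_minus_range_projection_sq:
  assumes V: "isometry V"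
  shows "(norm (x - V (adj V x)))\<^sup>2 = (norm x)\<^sup>2 - (norm (adj V x))\<^sup>2"
proof -
  have "cinner x (V (adj V x)) = cinner (adj V x) (adj V x)"
    by (simp add: V cinner_adj_left isometry_cblinear)
  then show ?thesis
    by (simp add: norm_diff_sq isometry_norm[OF V]) (simp add: norm_sq_Re_cinner)
qed

lemma isometry_adj_fixed_norm: "isometry V \<Longrightarrow> V (adj V x) = x \<Longrightarrow> norm (adj V x) = norm x"
  by (metis isometry_norm)

lemma isometry_adj_fixed_cinner:
  "isometry V \<Longrightarrow> V (adj V x) = x \<Longrightarrow> cinner (adj V x) (adj V y) = cinner x y"
  by (simp add: cinner_adj_right isometry_cblinear)

text \<open>The equation \<open>V x - l *\<^sub>C x = y\<close> is the fixed-point equation of a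
  contraction with constant \<open>1 / cmod l\<close>.\<close>

lemma isometry_minus_scaleC_bij:
  assumes V: "isometry V" and l: "cmod l > 1"
  shows "bij (\<lambda>x. V x - l *\<^sub>C x)"
proof -
  have l0: "l \<noteq> 0" using l by auto
  have ex: "\<exists>!x. V x - l *\<^sub>C x = y" for y
  proof -
    define f where "f x = (1 / l) *\<^sub>C (V x - y)" for x
    have "f x - f z = (1 / l) *\<^sub>C V (x - z)" for x z
      by (simp add: f_def cblinear_diff[OF isometry_cblinear[OF V]] flip: scaleC_diff_right)
    then have "dist (f x) (f z) \<le> (1 / cmod l) * dist x z" for x z
      by (simp add: dist_norm norm_scaleC norm_divide isometry_norm[OF V])
    then have "\<exists>!x. f x = x"
      using l by (intro banach_fix_type[of "1 / cmod l"]) (auto simp: divide_less_eq)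
    moreover have "f x = x \<longleftrightarrow> V x - l *\<^sub>C x = y" for x
    proof
      assume "f x = x"
      then have "l *\<^sub>C f x = l *\<^sub>C x" by simp
      then show "V x - l *\<^sub>C x = y"
        using l0 by (simp add: f_def scaleC_scaleC scaleC_one algebra_simps)
    next
      assume "V x - l *\<^sub>C x = y"
      then have "V x - y = l *\<^sub>C x" by (simp add: algebra_simps)
      then show "f x = x"
        using l0 by (simp add: f_def scaleC_scaleC scaleC_one)
    qed
    ultimately show ?thesis by simp
  qed
  show ?thesis
    unfolding bij_def inj_def surj_def using ex by metis
qed

section \<open>The Koszul complex\<close>

text \<open>One bijective operator suffices. At stage 2 write \<open>h1 = T1 h\<close>; then
  \<open>T1 h2 = T2 (T1 h) = T1 (T2 h)\<close>, and injectivity gives \<open>h2 = T2 h\<close>.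
  Stage 3 is solved with \<open>h1 = 0\<close>.\<close>

lemma koszul_exact_commute:
  assumes "\<And>x. T1 (T2 x) = T2 (T1 x)" "bij T1" "cblinear T1" "cblinear T2"
  shows "koszul_exact T1 T2"
proof -
  have T0: "T1 0 = 0" "T2 0 = 0"
    using assms cblinear_zero by blast+
  have inj: "T1 x = T1 y \<Longrightarrow> x = y" for x y
    using assms by (simp add: bij_is_inj inj_eq)
  have sur: "\<exists>x. y = T1 x" for y
    using assms by (metis bij_pointE)
  have "\<not> koszul_breaks_at T1 T2 1"
    using T0 inj unfolding koszul_breaks_at_def by (auto dest: inj[of _ 0])
  moreover have "\<exists>h. h1 = T1 h \<and> h2 = T2 h" if "T1 h2 = T2 h1" for h1 h2
    using sur[of h1] assms(1) inj that by metis
  then have "\<not> koszul_breaks_at T1 T2 2"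
    using assms(1) unfolding koszul_breaks_at_def by auto
  moreover have "\<exists>h1 h2. y = T1 h2 - T2 h1" for y
    using sur[of y] T0(2) diff_zero by metis
  then have "\<not> koszul_breaks_at T1 T2 3"
    unfolding koszul_breaks_at_def by auto
  ultimately show ?thesis
    unfolding koszul_exact_def by blast
qed

text \<open>Exchanging the two summands in the middle, with a sign at stage 3, identifies the two
  complexes.\<close>

lemma koszul_exact_swap:
  assumes "cblinear T1" "cblinear T2" and ex: "koszul_exact T1 T2"
  shows "koszul_exact T2 T1"
proof -
  have m: "T1 (- x) = - T1 x" "T2 (- x) = - T2 x" for x
    using assms cblinear_minus by blast+
  have e1: "{0} = {h. T1 h = 0 \<and> T2 h = 0}"
    and e2: "{(T1 h, T2 h) | h. True} = {(h1, h2). T1 h2 - T2 h1 = 0}"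
    and e3: "{T1 h2 - T2 h1 | h1 h2. True} = UNIV"
    using ex unfolding koszul_exact_def koszul_breaks_at_def by simp_all
  have "{0} = {h. T2 h = 0 \<and> T1 h = 0}"
    using e1 by blast
  moreover have "{(T2 h, T1 h) | h. True} = {(h1, h2). T2 h2 - T1 h1 = 0}"
  proof -
    have "{(T2 h, T1 h) | h. True} = prod.swap ` {(T1 h, T2 h) | h. True}"
      by force
    also have "\<dots> = prod.swap ` {(h1, h2). T1 h2 - T2 h1 = 0}"
      by (simp only: e2)
    also have "\<dots> = {(h1, h2). T2 h2 - T1 h1 = 0}"
      by (force simp: image_iff)
    finally show ?thesis .
  qed
  moreover have "{T2 h2 - T1 h1 | h1 h2. True} = UNIV"
  proof -
    have "\<exists>h1 h2. y = T2 h2 - T1 h1" for y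
    proof -
      have "y \<in> {T1 h2 - T2 h1 | h1 h2. True}"
        using e3 by simp
      then obtain h1 h2 where "y = T1 h2 - T2 h1" by blast
      then have "y = T2 (- h1) - T1 (- h2)" by (simp add: m)
      then show ?thesis by blast
    qed
    then show ?thesis by blast
  qed
  ultimately show ?thesis
    unfolding koszul_exact_def koszul_breaks_at_def by auto
qed

text \<open>Suppose every \<open>z\<close> is \<open>T1 h2 - T2 h1\<close>. Approximate null vectors
  of both adjoints, rescaled to norm \<open>n + 1\<close>, still have adjoint images of norm at most
  1, so their pairing with \<open>z\<close> is bounded by \<open>norm h2 + norm h1\<close>. Uniform
  boundedness contradicts their growing norms.\<close>

lemma koszul_breaks_at_3I:
  fixes T1 T2 :: "'a::chilbert_space \<Rightarrow> 'a"
  assumes T: "cblinear T1" "cblinear T2"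
    and approx: "\<And>\<epsilon>::real. \<epsilon> > 0 \<Longrightarrow> \<exists>y. norm y = 1 \<and> norm (adj T1 y) < \<epsilon> \<and> norm (adj T2 y) < \<epsilon>"
  shows "koszul_breaks_at T1 T2 3"
proof (rule ccontr)
  assume "\<not> ?thesis"
  then have sur: "z \<in> {T1 h2 - T2 h1 | h1 h2. True}" for z
    unfolding koszul_breaks_at_def by simp
  have "\<forall>n. \<exists>y. norm y = 1 \<and> norm (adj T1 y) < 1 / real (Suc n) \<and> norm (adj T2 y) < 1 / real (Suc n)"
    using approx by simp
  then obtain y where y: "\<And>n. norm (y n) = 1" "\<And>n. norm (adj T1 (y n)) < 1 / real (Suc n)"
      "\<And>n. norm (adj T2 (y n)) < 1 / real (Suc n)"
    by metis
  define u where "u n = complex_of_real (real (Suc n)) *\<^sub>C y n" for n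
  have nu: "norm (u n) = real (Suc n)" for n
    unfolding u_def norm_scaleC norm_of_real by (simp add: y)
  have "\<exists>K. \<forall>n. cmod (cinner z (u n)) \<le> K" for z
  proof -
    obtain h1 h2 where z: "z = T1 h2 - T2 h1"
      using sur by blast
    have adj_le: "norm (adj T (u n)) \<le> 1"
      if "cblinear T" "norm (adj T (y n)) < 1 / real (Suc n)" for T n
    proof -
      have "norm (adj T (u n)) = real (Suc n) * norm (adj T (y n))"
        unfolding u_def cblinear_scaleC[OF cblinear_adj[OF that(1)]] norm_scaleC norm_of_real by simp
      then show ?thesis
        using that(2) by (simp add: field_simps)
    qed
    have "cmod (cinner z (u n)) \<le> norm h2 + norm h1" for n
    proof -
      have "cinner z (u n) = cinner h2 (adj T1 (u n)) - cinner h1 (adj T2 (u n))"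
        by (simp add: z cinner_diff_left cinner_adj_right T)
      moreover have "cmod (cinner h2 (adj T1 (u n))) \<le> norm h2 * 1"
        using adj_le[OF T(1) y(2)] by (intro order.trans[OF norm_cinner_le] mult_left_mono) auto
      moreover have "cmod (cinner h1 (adj T2 (u n))) \<le> norm h1 * 1"
        using adj_le[OF T(2) y(3)] by (intro order.trans[OF norm_cinner_le] mult_left_mono) auto
      ultimately show ?thesis
        using norm_triangle_ineq4[of "cinner h2 (adj T1 (u n))" "cinner h1 (adj T2 (u n))"] by simp
    qed
    then show ?thesis by blast
  qed
  then obtain M where "\<And>n. norm (u n) \<le> M"
    using weakly_bounded_imp_bounded by blast
  then have "real (Suc n) \<le> M" for n
    by (simp add: nu del: of_nat_Suc)
  moreover obtain n where "M < real n"
    using reals_Archimedean2 by blast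
  ultimately show False
    by (meson le_less_trans less_le_not_le of_nat_le_iff le_SucI order.refl order.trans)
qed

section \<open>Pairs with nonpositive defect operator\<close>

text \<open>Membership in the two ranges is expressed through fixed points of the range projections,
  which makes closedness immediate.\<close>

definition defect_core :: "('a::chilbert_space \<Rightarrow> 'a) \<Rightarrow> ('a \<Rightarrow> 'a) \<Rightarrow> 'a set" where
  "defect_core V1 V2 = {x. V1 (adj V1 x) = x \<and> V2 (adj V2 x) = x \<and> adj V1 (adj V2 x) = 0}"

text \<open>The image of \<open>z\<^sub>1\<^sup>p z\<^sub>2\<^sup>q \<otimes> x\<close>. The index \<open>(0, 1)\<close> corresponds to \<open>x\<close> itself.\<close>
definition cell :: "('a::chilbert_space \<Rightarrow> 'a) \<Rightarrow> ('a \<Rightarrow> 'a) \<Rightarrow> nat \<times> nat \<Rightarrow> 'a \<Rightarrow> 'a" where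
  "cell V1 V2 m x = (case m of (p, q) \<Rightarrow>
     if p \<ge> q then ((\<lambda>y. V1 (V2 y)) ^^ q) ((adj V1 ^^ Suc (p - q)) x)
     else ((\<lambda>y. V1 (V2 y)) ^^ p) ((adj V2 ^^ (q - p - 1)) x))"

locale nonpositive_defect =
  fixes V1 V2 :: "'a::chilbert_space \<Rightarrow> 'a"
  assumes iso1: "isometry V1" and iso2: "isometry V2"
    and comm: "V1 (V2 x) = V2 (V1 x)"
    and defect_le: "Re (cinner (defect V1 V2 x) x) \<le> 0"
begin

abbreviation "A1 \<equiv> adj V1"
abbreviation "A2 \<equiv> adj V2"
abbreviation "E \<equiv> defect_core V1 V2"

lemmas lin = isometry_cblinear[OF iso1] isometry_cblinear[OF iso2]
lemmas lin_adj = cblinear_adj[OF lin(1)] cblinear_adj[OF lin(2)]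
lemmas AV = adj_isometry[OF iso1] adj_isometry[OF iso2]
lemmas zeros = cblinear_zero[OF lin(1)] cblinear_zero[OF lin(2)]
  cblinear_zero[OF lin_adj(1)] cblinear_zero[OF lin_adj(2)]
lemmas diffs = cblinear_diff[OF lin(1)] cblinear_diff[OF lin(2)]
  cblinear_diff[OF lin_adj(1)] cblinear_diff[OF lin_adj(2)]
lemmas adds = cblinear_add[OF lin(1)] cblinear_add[OF lin(2)]
  cblinear_add[OF lin_adj(1)] cblinear_add[OF lin_adj(2)]
lemmas scales = cblinear_scaleC[OF lin(1)] cblinear_scaleC[OF lin(2)]
  cblinear_scaleC[OF lin_adj(1)] cblinear_scaleC[OF lin_adj(2)]

section \<open>The core as the range of the defect operator\<close>

lemma adj_comm: "A1 (A2 x) = A2 (A1 x)"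
  using adj_compose[OF lin, of x] adj_compose[OF lin(2,1), of x] by (simp add: comm)

lemma defect_swap: "defect V2 V1 x = defect V1 V2 x"
  by (simp add: defect_def comm adj_comm algebra_simps)

text \<open>The hypotheses are symmetric, so each fact about one operator transfers to the other
  through this lemma and \<open>core_swap\<close>.\<close>

lemma swap: "nonpositive_defect V2 V1"
  by unfold_locales (simp_all add: iso1 iso2 comm defect_swap defect_le)

lemma core_swap: "defect_core V2 V1 = E"
  by (auto simp: defect_core_def adj_comm)

text \<open>On \<open>ker A1\<close> the quadratic form of the defect reduces to
  \<open>norm x\<close> squared minus \<open>norm (A2 x)\<close> squared, the squared distance of
  \<open>x\<close> to \<open>ran V2\<close>; nonpositivity makes it zero.\<close>

lemma ker1_subset_ran2:
  assumes "A1 x = 0"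
  shows "V2 (A2 x) = x"
proof -
  have "cinner (defect V1 V2 x) x = cinner (x - V2 (A2 x)) x"
    by (simp add: defect_def assms zeros)
  also have "\<dots> = cinner x x - cinner (A2 x) (A2 x)"
    by (simp add: cinner_diff_left cinner_adj_right lin)
  finally have "(norm x)\<^sup>2 - (norm (A2 x))\<^sup>2 \<le> 0"
    using defect_le[of x] by (simp add: norm_sq_Re_cinner)
  then have "(norm (x - V2 (A2 x)))\<^sup>2 \<le> 0"
    by (simp add: norm_minus_range_projection_sq[OF iso2])
  then show ?thesis by simp
qed

lemma ker2_subset_ran1: "A2 x = 0 \<Longrightarrow> V1 (A1 x) = x"
  by (rule nonpositive_defect.ker1_subset_ran2[OF swap])

lemma coreD: "x \<in> E \<Longrightarrow> V1 (A1 x) = x" "x \<in> E \<Longrightarrow> V2 (A2 x) = x" "x \<in> E \<Longrightarrow> A1 (A2 x) = 0"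
    "x \<in> E \<Longrightarrow> A2 (A1 x) = 0"
  by (auto simp: defect_core_def adj_comm)

text \<open>Split the defect into \<open>x - V1 (A1 x)\<close>, which lies in \<open>ker A1\<close>
  and so in \<open>ran V2\<close>, and a term visibly in \<open>ran V2\<close>.\<close>

lemma ran2_defect: "V2 (A2 (defect V1 V2 x)) = defect V1 V2 x"
proof -
  have "defect V1 V2 x = (x - V1 (A1 x)) - V2 (A2 x - V1 (A1 (A2 x)))"
    by (simp add: defect_def diffs comm adj_comm algebra_simps)
  moreover have "V2 (A2 (x - V1 (A1 x))) = x - V1 (A1 x)"
    by (rule ker1_subset_ran2) (simp add: diffs AV)
  ultimately show ?thesis
    by (simp add: diffs AV) (simp add: algebra_simps)
qed

text \<open>Under \<open>A1 A2\<close> the four terms of the defect cancel in pairs; the range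
  conditions are \<open>ran2_defect\<close> and its mirror image.\<close>

lemma defect_in_core: "defect V1 V2 x \<in> E"
proof -
  have "A1 (A2 (defect V1 V2 x)) = 0"
    by (simp add: defect_def diffs adds AV zeros comm flip: adj_comm)
      (simp add: adj_comm AV)
  moreover have "V1 (A1 (defect V1 V2 x)) = defect V1 V2 x"
    using nonpositive_defect.ran2_defect[OF swap, of x] by (simp add: defect_swap)
  ultimately show ?thesis
    by (simp add: defect_core_def ran2_defect)
qed

lemma defect_core_eq: "x \<in> E \<Longrightarrow> defect V1 V2 x = - x"
  by (simp add: defect_def coreD zeros)

lemma range_defect: "range (defect V1 V2) = E"
proof -
  have "x = defect V1 V2 (- x)" if "x \<in> E" for x
  proof -
    have "- x \<in> E"
      using that lin lin_adj by (simp add: defect_core_def cblinear_minus)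
    then show ?thesis
      by (simp add: defect_core_eq)
  qed
  then show ?thesis
    using defect_in_core by blast
qed

lemma cinner_defect: "cinner (defect V1 V2 x) y = cinner x (defect V1 V2 y)"
proof -
  have a: "cinner (V1 u) v = cinner u (A1 v)" "cinner (V2 u) v = cinner u (A2 v)" for u v
    by (simp_all add: cinner_adj_right lin)
  have b: "cinner u (V1 v) = cinner (A1 u) v" "cinner u (V2 v) = cinner (A2 u) v" for u v
    by (simp_all add: cinner_adj_left lin)
  show ?thesis
    by (simp only: defect_def cinner_diff_left cinner_diff_right cinner_add_left cinner_add_right a b adj_comm)
qed

text \<open>A self-adjoint operator vanishes on the orthogonal complement of its range.\<close>

lemma defect_orth_core:
  assumes "x \<in> orth E"
  shows "defect V1 V2 x = 0"
proof (rule cinner_ext)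
  fix z
  have "cinner (defect V1 V2 z) x = 0"
    using assms defect_in_core unfolding orth_def by blast
  then show "cinner z (defect V1 V2 x) = cinner z 0"
    by (simp add: cinner_defect)
qed

lemma closed_csubspace_core: "closed_csubspace E"
proof -
  have "E = {x. V1 (A1 x) = x} \<inter> {x. V2 (A2 x) = x} \<inter> {x. A1 (A2 x) = (\<lambda>_. 0) x}"
    by (auto simp: defect_core_def)
  moreover have "cblinear (\<lambda>_::'a. 0::'a)"
    by (auto simp: cblinear_def intro: exI[of _ 0])
  ultimately have "closed E"
    using closed_cblinear_eq[OF cblinear_compose[OF lin(1) lin_adj(1)] cblinear_id]
      closed_cblinear_eq[OF cblinear_compose[OF lin(2) lin_adj(2)] cblinear_id]
      closed_cblinear_eq[OF cblinear_compose[OF lin_adj]]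
    by (simp only: closed_Int)
  then show ?thesis
    by (simp add: closed_csubspace_def csubspace_def) (simp add: defect_core_def zeros adds scales)
qed

section \<open>Powers of the adjoints on the core\<close>

lemma A2_A1_pow: "A2 x = 0 \<Longrightarrow> A2 ((A1 ^^ p) x) = 0"
  by (induction p) (simp_all add: zeros flip: adj_comm)

text \<open>\<open>A1 x\<close> lies in \<open>ker A2\<close>, which is \<open>A1\<close>-invariant.
  The exponent starts at one because \<open>x\<close> itself lies in \<open>ran V2\<close>.\<close>

lemma core_A2_A1_pow: "x \<in> E \<Longrightarrow> A2 ((A1 ^^ Suc p) x) = 0"
  using A2_A1_pow[of "A1 x" p] coreD by (simp add: funpow_Suc_right del: funpow.simps)

lemma core_A1_A2_pow: "x \<in> E \<Longrightarrow> A1 ((A2 ^^ Suc p) x) = 0"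
  using nonpositive_defect.core_A2_A1_pow[OF swap] by (simp add: core_swap del: funpow.simps)

text \<open>The orbit of a core vector under \<open>A1\<close> stays in \<open>ran V1\<close>: at
  exponent zero by definition of the core, later because it lies in \<open>ker A2\<close>. Hence
  \<open>A1\<close> is isometric along the orbit.\<close>

lemma core_V1_A1_pow:
  assumes "x \<in> E"
  shows "V1 (A1 ((A1 ^^ p) x)) = (A1 ^^ p) x"
proof (cases p)
  case 0
  then show ?thesis using assms coreD by simp
next
  case (Suc r)
  then show ?thesis
    using ker2_subset_ran1 core_A2_A1_pow[OF assms, of r] by simp
qed

lemma core_V2_A2_pow: "x \<in> E \<Longrightarrow> V2 (A2 ((A2 ^^ p) x)) = (A2 ^^ p) x"
  using nonpositive_defect.core_V1_A1_pow[OF swap] by (simp add: core_swap)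

lemma norm_A1_pow: "x \<in> E \<Longrightarrow> norm ((A1 ^^ p) x) = norm x"
  by (induction p) (simp_all add: isometry_adj_fixed_norm iso1 core_V1_A1_pow)

lemma norm_A2_pow: "x \<in> E \<Longrightarrow> norm ((A2 ^^ p) x) = norm x"
  using nonpositive_defect.norm_A1_pow[OF swap] by (simp add: core_swap)

text \<open>Common factors \<open>A1\<close> are stripped isometrically; what remains pairs
  \<open>x\<close>, in \<open>ran V2\<close>, with a positive power of \<open>A1\<close>, in
  \<open>ker A2\<close>.\<close>

lemma A1_pow_orth: "x \<in> E \<Longrightarrow> y \<in> E \<Longrightarrow> p < q \<Longrightarrow> cinner ((A1 ^^ p) x) ((A1 ^^ q) y) = 0"
proof (induction p arbitrary: q)
  case 0
  then obtain r where q: "q = Suc r"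
    using gr0_implies_Suc by blast
  have "cinner (V2 (A2 x)) ((A1 ^^ q) y) = cinner (A2 x) (A2 ((A1 ^^ q) y))"
    by (simp add: cinner_adj_right lin)
  then show ?case
    using 0 core_A2_A1_pow[of y r] coreD q by (simp del: funpow.simps add: funpow_0)
next
  case (Suc p)
  then obtain r where q: "q = Suc r" and "p < r"
    by (metis Suc_lessE)
  then show ?case
    using Suc by (simp add: isometry_adj_fixed_cinner iso1 core_V1_A1_pow)
qed

lemma A2_pow_orth: "x \<in> E \<Longrightarrow> y \<in> E \<Longrightarrow> p < q \<Longrightarrow> cinner ((A2 ^^ p) x) ((A2 ^^ q) y) = 0"
  using nonpositive_defect.A1_pow_orth[OF swap] by (simp add: core_swap)

lemma A1_A2_pow_orth:
  assumes "x \<in> E" "y \<in> E"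
  shows "cinner ((A1 ^^ Suc p) x) ((A2 ^^ q) y) = 0"
proof -
  have "cinner ((A1 ^^ Suc p) x) ((A2 ^^ q) y) = cinner ((A1 ^^ Suc p) x) (V2 (A2 ((A2 ^^ q) y)))"
    using assms by (simp add: core_V2_A2_pow)
  also have "\<dots> = cinner (A2 ((A1 ^^ Suc p) x)) (A2 ((A2 ^^ q) y))"
    by (simp only: cinner_adj_left[OF lin(2)])
  finally show ?thesis
    by (simp only: core_A2_A1_pow[OF assms(1)] cinner_zero_left)
qed

section \<open>The cells and their permutation by the two isometries\<close>

abbreviation "V \<equiv> (\<lambda>y. V1 (V2 y))"

lemma isometry_V_pow: "isometry (V ^^ k)"
proof (induction k)
  case 0
  then show ?case by (simp add: isometry_def cblinear_id id_def)
next
  case (Suc k)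
  then show ?case
    using isometry_compose[OF isometry_compose[OF iso1 iso2] Suc] by (simp add: comp_def)
qed

lemma V1_V_pow: "V1 ((V ^^ k) x) = (V ^^ k) (V1 x)"
  by (induction k) (simp_all add: comm)

lemma V2_V_pow: "V2 ((V ^^ k) x) = (V ^^ k) (V2 x)"
  by (induction k) (simp_all flip: comm)

text \<open>\<open>y\<close> lies in the kernel of the adjoint of \<open>V\<close>, hence is
  orthogonal to \<open>ran V\<close>; common powers of \<open>V\<close> are stripped first.\<close>

lemma V_pow_orth:
  assumes "A1 (A2 y) = 0"
  shows "j < k \<Longrightarrow> cinner ((V ^^ k) x) ((V ^^ j) y) = 0"
proof (induction j arbitrary: k)
  case 0
  then obtain r where "k = Suc r"
    using gr0_implies_Suc by blast
  then show ?case
    using assms by (simp add: adj_comm flip: cinner_adj_right[OF lin(1)] cinner_adj_right[OF lin(2)])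
next
  case (Suc j)
  then obtain r where "k = Suc r" "j < r"
    by (metis Suc_lessE)
  then show ?case
    using Suc by (simp add: isometry_cinner iso1 iso2)
qed

lemma cblinear_cell: "cblinear (cell V1 V2 m)"
proof -
  obtain p q where m: "m = (p, q)" by force
  show ?thesis
    unfolding cell_def m prod.case
    by (cases "p \<ge> q")
      (simp_all add: cblinear_compose cblinear_funpow lin lin_adj del: funpow.simps)
qed

lemma norm_cell: "x \<in> E \<Longrightarrow> norm (cell V1 V2 m x) = norm x"
  by (cases m) (simp add: cell_def isometry_norm[OF isometry_V_pow] norm_A1_pow norm_A2_pow del: funpow.simps)

text \<open>Each cell is a power of \<open>V\<close> applied to a vector of
  \<open>ker (A1 A2)\<close>. Different powers are separated by \<open>V_pow_orth\<close>; for equal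
  powers the orthogonality relations between the powers of \<open>A1\<close> and \<open>A2\<close>
  decide.\<close>

lemma cell_orth:
  assumes x: "x \<in> E" and y: "y \<in> E" and mn: "m \<noteq> n"
  shows "cinner (cell V1 V2 m x) (cell V1 V2 n y) = 0"
proof -
  define k where "k m = min (fst m) (snd m)" for m :: "nat \<times> nat"
  define g where "g m x = (if fst m \<ge> snd m then (A1 ^^ Suc (fst m - snd m)) x
      else (A2 ^^ (snd m - fst m - 1)) x)" for m :: "nat \<times> nat" and x
  have cg: "cell V1 V2 m x = (V ^^ k m) (g m x)" for m x
    by (cases m) (simp add: cell_def k_def g_def min_def del: funpow.simps)
  have ker: "A1 (A2 (g m x)) = 0" if "x \<in> E" for m x
  proof (cases "fst m \<ge> snd m")
    case True
    then show ?thesis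
      using core_A2_A1_pow[OF that, of "fst m - snd m"] by (simp add: g_def zeros del: funpow.simps)
  next
    case False
    then show ?thesis
      using core_A1_A2_pow[OF that, of "snd m - fst m - 1"] by (simp add: g_def)
  qed
  show ?thesis
  proof (cases "k m = k n")
    case False
    then consider "k m < k n" | "k n < k m" by linarith
    then show ?thesis
      unfolding cg by cases (use V_pow_orth ker x y cinner_commute_zero in blast)+
  next
    case True
    have "cinner (g m x) (g n y) = 0"
    proof -
      consider (a) "fst m \<ge> snd m" "fst n \<ge> snd n" | (b) "fst m < snd m" "fst n < snd n"
        | (c) "fst m \<ge> snd m" "fst n < snd n" | (d) "fst m < snd m" "fst n \<ge> snd n"
        by linarith
      then show ?thesis
      proof cases
        case a
        \<comment> \<open>On this side of the diagonal the power of \<open>V\<close> is the second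
          index, so distinct indices must differ in the exponent of \<open>A1\<close>.\<close>
        then have "snd m = snd n" "fst m \<noteq> fst n"
          using True mn by (auto simp: k_def min_def prod_eq_iff split: if_splits)
        then have "Suc (fst m - snd m) < Suc (fst n - snd n) \<or> Suc (fst n - snd n) < Suc (fst m - snd m)"
          using a by linarith
        then have "cinner ((A1 ^^ Suc (fst m - snd m)) x) ((A1 ^^ Suc (fst n - snd n)) y) = 0"
          using A1_pow_orth[OF x y] A1_pow_orth[OF y x] cinner_commute_zero by metis
        then show ?thesis
          using a by (simp add: g_def del: funpow.simps)
      next
        case b
        then have "fst m = fst n" "snd m \<noteq> snd n"
          using True mn by (auto simp: k_def min_def prod_eq_iff split: if_splits)
        then have "snd m - fst m - 1 < snd n - fst n - 1 \<or> snd n - fst n - 1 < snd m - fst m - 1"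
          using b by linarith
        then have "cinner ((A2 ^^ (snd m - fst m - 1)) x) ((A2 ^^ (snd n - fst n - 1)) y) = 0"
          using A2_pow_orth[OF x y] A2_pow_orth[OF y x] cinner_commute_zero by metis
        then show ?thesis
          using b by (simp add: g_def del: funpow.simps)
      next
        case c
        then show ?thesis
          using A1_A2_pow_orth[OF x y] unfolding g_def by (simp del: funpow.simps)
      next
        case d
        then show ?thesis
          using A1_A2_pow_orth[OF y x] cinner_commute_zero unfolding g_def
          by (simp del: funpow.simps) blast
      qed
    qed
    then show ?thesis
      by (simp add: cg True isometry_cinner isometry_V_pow)
  qed
qed

text \<open>\<open>n\<close> is the index to which \<open>tau1\<close> moves \<open>(p, q)\<close>.
  For \<open>p > q\<close> the operator \<open>V1\<close> cancels one factor \<open>A1\<close>; for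
  \<open>p = q\<close> it cancels the only one, leaving \<open>x\<close> under the power of
  \<open>V\<close>; for \<open>p < q\<close> inserting \<open>V2 A2\<close> turns \<open>V1\<close>
  into a further factor \<open>V\<close>.\<close>

lemma V1_cell:
  assumes x: "x \<in> E" and n: "Umap n = (Suc p, q)"
  shows "V1 (cell V1 V2 (p, q) x) = cell V1 V2 n x"
proof -
  obtain n1 n2 where n12: "n = (n1, n2)" by force
  consider (a) "n1 \<ge> n2" | (b) "Suc n1 = n2" | (c) "n1 + 2 \<le> n2" by linarith
  then show ?thesis
  proof cases
    case a
    then have pq: "p = Suc n1" "q = n2"
      using n n12 by (auto simp: Umap_def)
    have "cell V1 V2 (p, q) x = (V ^^ n2) (A1 ((A1 ^^ Suc (n1 - n2)) x))"
      using a by (simp add: cell_def pq Suc_diff_le)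
    then show ?thesis
      using a x by (simp only: V1_V_pow core_V1_A1_pow) (simp add: n12 cell_def)
  next
    case b
    then have pq: "p = n1" "q = n1"
      using n n12 by (auto simp: Umap_def)
    show ?thesis
      using b x by (simp add: n12 cell_def pq V1_V_pow coreD)
  next
    case c
    then have pq: "n1 = Suc p" "q = n2 - 2"
      using n n12 by (auto simp: Umap_def)
    then obtain d where d: "n2 = Suc (Suc (Suc (p + d)))"
      using c by (metis add_Suc_right add_2_eq_Suc' le_Suc_ex add_Suc)
    have "(V ^^ n1) ((A2 ^^ Suc d) x) = (V ^^ p) (V1 (V2 (A2 ((A2 ^^ d) x))))"
      by (simp only: pq(1) funpow_Suc_right[of p V] o_apply) simp
    then show ?thesis
      using c x by (simp add: n12 cell_def pq d V1_V_pow core_V2_A2_pow del: funpow.simps)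
  qed
qed

text \<open>The index on the right is that of \<open>tau2\<close>. In case \<open>c\<close> a factor
  \<open>A2\<close> is cancelled; otherwise \<open>V1 A1\<close> is inserted and
  \<open>V2 V1\<close> becomes a further factor \<open>V\<close>.\<close>

lemma V2_cell:
  assumes x: "x \<in> E"
  shows "V2 (cell V1 V2 m x) = cell V1 V2 (fst (Umap m), Suc (snd (Umap m))) x"
proof -
  obtain m1 m2 where m: "m = (m1, m2)" by force
  consider (a) "m1 \<ge> m2" | (b) "Suc m1 = m2" | (c) "m1 + 2 \<le> m2" by linarith
  then show ?thesis
  proof cases
    case a
    have "(V ^^ Suc m2) ((A1 ^^ Suc (Suc (m1 - m2))) x) = (V ^^ m2) (V2 (V1 (A1 ((A1 ^^ Suc (m1 - m2)) x))))"
      by (simp only: funpow_Suc_right[of m2 V] o_apply) (simp add: comm)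
    then show ?thesis
      using a x by (simp add: m cell_def Umap_def V2_V_pow core_V1_A1_pow Suc_diff_le del: funpow.simps)
  next
    case b
    have "(V ^^ Suc m1) (A1 x) = (V ^^ m1) (V2 (V1 (A1 x)))"
      by (simp only: funpow_Suc_right[of m1 V] o_apply) (simp add: comm)
    moreover have "(A1 ^^ Suc 0) x = A1 x"
      by simp
    ultimately show ?thesis
      using b x by (simp add: m cell_def Umap_def V2_V_pow coreD del: funpow.simps(2))
  next
    case c
    then obtain d where d: "m2 = Suc (Suc (m1 + d))"
      by (metis add_2_eq_Suc' add_Suc le_Suc_ex)
    have "V2 ((V ^^ m1) ((A2 ^^ Suc d) x)) = (V ^^ m1) ((A2 ^^ d) x)"
      using x by (simp add: V2_V_pow core_V2_A2_pow)
    then show ?thesis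
      using c by (simp add: m cell_def Umap_def d del: funpow.simps)
  qed
qed

text \<open>Here \<open>n\<close> has no predecessor under the index map of \<open>V1\<close>. Its
  first entry is 0 and its second at least 2, so the cell is a positive power of \<open>A2\<close>,
  which \<open>A1\<close> kills.\<close>

lemma A1_cell_boundary:
  assumes x: "x \<in> E" and n: "fst (Umap n) = 0"
  shows "A1 (cell V1 V2 n x) = 0"
proof -
  obtain n1 n2 where n12: "n = (n1, n2)" by force
  then have "n1 = 0" "2 \<le> n2"
    using n by (auto simp: Umap_def split: if_splits)
  then obtain d where "n1 = 0" "n2 = Suc (Suc d)"
    by (metis add_2_eq_Suc le_Suc_ex)
  then show ?thesis
    using core_A1_A2_pow[OF x, of d] by (simp add: n12 cell_def del: funpow.simps(2))
qed

lemma A2_cell_boundary: "x \<in> E \<Longrightarrow> A2 (cell V1 V2 (n, 0) x) = 0"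
  using core_A2_A1_pow[of x n] by (simp add: cell_def del: funpow.simps(2))

section \<open>Breaking of the Koszul complex and the joint spectrum\<close>

lemma core_adj_kernel: "x \<in> E \<Longrightarrow> A2 h = 0 \<Longrightarrow> cinner x h = 0"
  using coreD(2)[of x] cinner_adj_right[OF lin(2), of "A2 x" h] by simp

text \<open>The contraction \<open>f h = A1 (x + l *\<^sub>C h)\<close> preserves
  \<open>ker A2\<close>. Since \<open>V1 A1\<close> fixes both \<open>x\<close> and
  \<open>ker A2\<close>, applying \<open>V1\<close> to the fixed-point equation gives
  \<open>V1 h = x + l *\<^sub>C h\<close>.\<close>

lemma resolvent_vector:
  assumes x: "x \<in> E" and l: "cmod l < 1"
  obtains h where "A2 h = 0" "V1 h - l *\<^sub>C h = x"
proof -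
  let ?K = "{h. A2 h = 0}"
  define f where "f h = A1 (x + l *\<^sub>C h)" for h
  have "closed ?K"
    by (intro closed_Collect_eq linear_continuous_on cblinear_imp_bounded_linear lin_adj continuous_on_const)
  then have "complete ?K"
    by (simp add: complete_eq_closed)
  moreover have "?K \<noteq> {}"
    using zeros by blast
  moreover have "f ` ?K \<subseteq> ?K"
    using coreD[OF x] by (auto simp: f_def adds scales zeros simp flip: adj_comm)
  moreover have "dist (f u) (f v) \<le> cmod l * dist u v" for u v
  proof -
    have "f u - f v = A1 (l *\<^sub>C (u - v))"
      by (simp add: f_def adds scaleC_diff_right diffs)
    then show ?thesis
      using norm_adj_isometry_le[OF iso1, of "l *\<^sub>C (u - v)"] by (simp add: dist_norm norm_scaleC)
  qed
  ultimately have "\<exists>!h\<in>?K. f h = h"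
    using l by (intro Banach_fix[where c = "cmod l"]) auto
  then obtain h where h: "A2 h = 0" "f h = h" by blast
  have "V1 h = V1 (A1 (x + l *\<^sub>C h))"
    using h(2) by (simp add: f_def)
  also have "\<dots> = x + l *\<^sub>C h"
    by (simp add: adds scales coreD[OF x] ker2_subset_ran1[OF h(1)])
  finally show thesis
    using h(1) that by simp
qed

lemma koszul_breaks_at_2:
  assumes x: "x \<in> E" "x \<noteq> 0" and l: "cmod l1 < 1" "cmod l2 < 1"
  shows "koszul_breaks_at (\<lambda>x. V1 x - l1 *\<^sub>C x) (\<lambda>x. V2 x - l2 *\<^sub>C x) 2"
proof -
  obtain h2 where h2: "A2 h2 = 0" "V1 h2 - l1 *\<^sub>C h2 = x"
    using resolvent_vector x l by blast
  obtain h1 where h1: "V2 h1 - l2 *\<^sub>C h1 = x"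
    using nonpositive_defect.resolvent_vector[OF swap, of x l2] x l core_swap by auto
  have "(h1, h2) \<in> {(h1, h2). (V1 h2 - l1 *\<^sub>C h2) - (V2 h1 - l2 *\<^sub>C h1) = 0}"
    using h1 h2 by simp
  moreover have "h2 \<noteq> V2 h - l2 *\<^sub>C h" for h
  proof
    assume eq: "h2 = V2 h - l2 *\<^sub>C h"
    \<comment> \<open>Obtained by applying \<open>A2\<close>; as \<open>A2\<close> is a contraction
      and \<open>cmod l2 < 1\<close>, only \<open>h = 0\<close> is possible.\<close>
    then have "h = l2 *\<^sub>C A2 h"
      using h2(1) by (simp add: diffs scales AV)
    then have "norm h \<le> cmod l2 * norm h"
      by (metis mult_left_mono norm_adj_isometry_le iso2 norm_ge_zero norm_scaleC)
    then have "(1 - cmod l2) * norm h \<le> 0"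
      by (simp add: algebra_simps)
    then have "h = 0"
      using l(2) by (simp add: mult_le_0_iff)
    then have "x = 0"
      using eq h2 by (simp add: zeros)
    with x show False by simp
  qed
  ultimately have "{(V1 h - l1 *\<^sub>C h, V2 h - l2 *\<^sub>C h) |h. True}
      \<noteq> {(h1, h2). (V1 h2 - l1 *\<^sub>C h2) - (V2 h1 - l2 *\<^sub>C h1) = 0}"
    by blast
  then show ?thesis
    unfolding koszul_breaks_at_def by simp
qed

text \<open>Take the resolvent vector at \<open>s l\<close> with \<open>s\<close> slightly below 1.
  Since \<open>x\<close> is orthogonal to \<open>h\<close>, Pythagoras turns
  \<open>V1 h = x + s l h\<close> into a bound of \<open>norm x\<close> by a small multiple of
  \<open>norm h\<close>; replacing \<open>s l\<close> by \<open>l\<close> costs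
  \<open>(1 - s) * norm h\<close>.\<close>

lemma approx_eigenvector:
  assumes x: "x \<in> E" "x \<noteq> 0" and l: "cmod l = 1" and \<delta>: "\<delta> > (0::real)"
  obtains h where "A2 h = 0" "h \<noteq> 0" "norm (V1 h - l *\<^sub>C h) < \<delta> * norm h"
proof -
  define d where "d = min \<delta> 1"
  have d: "0 < d" "d \<le> \<delta>" "d \<le> 1"
    using \<delta> by (auto simp: d_def)
  \<comment> \<open>Chosen so that both \<open>1 - s\<close> and the square root of
    \<open>1 - s\<^sup>2\<close> are at most \<open>d / 2\<close>; the cap \<open>d \<le> 1\<close>
    keeps \<open>s\<close> positive.\<close>
  define s where "s = 1 - d\<^sup>2 / 16"
  have dd: "d\<^sup>2 \<le> d"
    using d by (simp add: power2_eq_square mult_left_le)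
  have s: "0 < s" "s < 1" "1 - s < d / 2"
    unfolding s_def using d dd zero_less_power[OF d(1), of 2] by linarith+
  have s2: "1 - s\<^sup>2 \<le> (d / 2)\<^sup>2"
  proof -
    have "1 - s\<^sup>2 = (1 - s) * (1 + s)"
      by (simp add: power2_eq_square algebra_simps)
    also have "\<dots> \<le> (1 - s) * 2"
      using s by (intro mult_left_mono) auto
    also have "\<dots> \<le> (d / 2)\<^sup>2"
      by (simp add: s_def power_divide)
    finally show ?thesis .
  qed
  have cs: "cmod (complex_of_real s * l) = s"
    using s l by (simp add: norm_mult)
  obtain h where h: "A2 h = 0" "V1 h - (complex_of_real s * l) *\<^sub>C h = x"
    using resolvent_vector[OF x(1), of "complex_of_real s * l"] cs s by auto
  have h0: "h \<noteq> 0"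
    using h x by (auto simp: zeros)
  have "V1 h = x + (complex_of_real s * l) *\<^sub>C h"
    using h(2) by (metis add.commute diff_add_cancel)
  then have "(norm h)\<^sup>2 = (norm (x + (complex_of_real s * l) *\<^sub>C h))\<^sup>2"
    by (metis isometry_norm iso1)
  also have "\<dots> = (norm x)\<^sup>2 + s\<^sup>2 * (norm h)\<^sup>2"
    using core_adj_kernel[OF x(1) h(1)]
    by (subst norm_add_sq_orth) (simp_all add: cinner_scaleC_right norm_scaleC power_mult_distrib norm_mult l)
  finally have "(norm x)\<^sup>2 = (1 - s\<^sup>2) * (norm h)\<^sup>2"
    by (simp add: algebra_simps)
  also have "\<dots> \<le> (d / 2)\<^sup>2 * (norm h)\<^sup>2"
    using s2 by (intro mult_right_mono) auto
  finally have "(norm x)\<^sup>2 \<le> (d / 2 * norm h)\<^sup>2"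
    by (simp only: power_mult_distrib)
  then have nx: "norm x \<le> d / 2 * norm h"
    by (rule power2_le_imp_le) (use d in simp)
  have "V1 h - l *\<^sub>C h = x - (complex_of_real (1 - s) * l) *\<^sub>C h"
  proof -
    have "l *\<^sub>C h = (complex_of_real s * l) *\<^sub>C h + (complex_of_real (1 - s) * l) *\<^sub>C h"
      by (simp add: algebra_simps flip: scaleC_add_left)
    then show ?thesis
      using h(2) by (simp add: algebra_simps)
  qed
  then have "norm (V1 h - l *\<^sub>C h) \<le> norm x + norm ((complex_of_real (1 - s) * l) *\<^sub>C h)"
    using norm_triangle_ineq4 by simp
  also have "norm ((complex_of_real (1 - s) * l) *\<^sub>C h) = (1 - s) * norm h"
    using s l by (simp add: norm_scaleC norm_mult del: of_real_diff)
  also have "norm x + (1 - s) * norm h < d / 2 * norm h + d / 2 * norm h"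
    using nx s h0 by (intro add_le_less_mono mult_strict_right_mono) auto
  also have "\<dots> \<le> \<delta> * norm h"
    using d by (simp add: mult_right_mono flip: distrib_right)
  finally show thesis
    using h(1) h0 that by blast
qed

text \<open>With \<open>h\<close> from \<open>approx_eigenvector\<close>, the solution of
  \<open>y = h + \<mu> V2 y\<close> is an exact eigenvector of \<open>A2\<close>, because
  \<open>A2 h = 0\<close>. It inherits the approximate eigenvalue from \<open>h\<close>, since
  \<open>V1\<close> commutes with \<open>V2\<close>.\<close>

lemma joint_approx_eigenvector:
  assumes x: "x \<in> E" "x \<noteq> 0" and l: "cmod l1 = 1" "cmod l2 \<le> 1" and \<epsilon>: "\<epsilon> > (0::real)"
  shows "\<exists>y. norm y = 1 \<and> norm (A1 y - cnj l1 *\<^sub>C y) < \<epsilon> \<and> norm (A2 y - cnj l2 *\<^sub>C y) < \<epsilon>"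
proof -
  define r where "r = max 0 (1 - \<epsilon> / 2)"
  have r: "0 \<le> r" "r < 1" "1 - r < \<epsilon>"
    using \<epsilon> by (auto simp: r_def)
  \<comment> \<open>The factor \<open>r < 1\<close> makes the equation for \<open>y\<close> a
    contraction even when \<open>cmod l2 = 1\<close>.\<close>
  define \<mu> where "\<mu> = complex_of_real r * cnj l2"
  have \<mu>r: "cmod \<mu> \<le> r"
    using r l by (simp add: \<mu>_def norm_mult mult_left_le)
  \<comment> \<open>The factor \<open>1 - r\<close> compensates the loss \<open>1 / (1 - r)\<close>
    in passing from \<open>h\<close> to \<open>y\<close>.\<close>
  have pos: "0 < \<epsilon> * (1 - r)"
    using \<epsilon> r by simp
  from approx_eigenvector[OF x l(1) pos]
  obtain h where h: "A2 h = 0" "h \<noteq> 0" "norm (V1 h - l1 *\<^sub>C h) < (\<epsilon> * (1 - r)) * norm h"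
    by blast
  have "\<exists>!y. h + \<mu> *\<^sub>C V2 y = y"
  proof (rule banach_fix_type)
    show "\<forall>x y. dist (h + \<mu> *\<^sub>C V2 x) (h + \<mu> *\<^sub>C V2 y) \<le> r * dist x y"
    proof (intro allI)
      fix x y
      have "dist (h + \<mu> *\<^sub>C V2 x) (h + \<mu> *\<^sub>C V2 y) = cmod \<mu> * dist x y"
        by (simp add: dist_norm norm_scaleC isometry_norm[OF iso2] flip: scaleC_diff_right diffs)
      then show "dist (h + \<mu> *\<^sub>C V2 x) (h + \<mu> *\<^sub>C V2 y) \<le> r * dist x y"
        using \<mu>r by (simp add: mult_right_mono)
    qed
  qed (use r in auto)
  then obtain y where y: "y = h + \<mu> *\<^sub>C V2 y" by metis
  have A2y: "A2 y = \<mu> *\<^sub>C y"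
    using arg_cong[OF y, of A2] h by (simp add: adds scales AV)
  have "cinner h (\<mu> *\<^sub>C V2 y) = 0"
    using h(1) by (simp add: cinner_scaleC_right flip: cinner_adj_left[OF lin(2)])
  then have "(norm h)\<^sup>2 \<le> (norm y)\<^sup>2"
    by (subst y) (simp add: norm_add_sq_orth)
  then have hy: "norm h \<le> norm y"
    by (rule power2_le_imp_le) simp
  then have y0: "norm y > 0"
    using h(2) by (meson less_le_trans zero_less_norm_iff)
  \<comment> \<open>\<open>w\<close> satisfies the equation of \<open>y\<close> with
    \<open>V1 h - l1 *\<^sub>C h\<close> in place of \<open>h\<close>.\<close>
  define w where "w = V1 y - l1 *\<^sub>C y"
  have "w = (V1 h - l1 *\<^sub>C h) + \<mu> *\<^sub>C V2 w"
  proof -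
    have "w = V1 (h + \<mu> *\<^sub>C V2 y) - l1 *\<^sub>C (h + \<mu> *\<^sub>C V2 y)"
      using y unfolding w_def by metis
    also have "\<dots> = (V1 h - l1 *\<^sub>C h) + \<mu> *\<^sub>C V2 w"
      by (simp add: w_def adds diffs scales comm scaleC_add_right scaleC_diff_right scaleC_scaleC mult.commute)
    finally show ?thesis .
  qed
  then have "norm w \<le> norm (V1 h - l1 *\<^sub>C h) + cmod \<mu> * norm w"
    by (metis isometry_norm iso2 norm_scaleC norm_triangle_ineq)
  also have "\<dots> < (\<epsilon> * (1 - r)) * norm y + r * norm w"
    using h(3) mult_left_mono[OF hy less_imp_le[OF pos]] mult_right_mono[OF \<mu>r norm_ge_zero[of w]]
    by linarith
  finally have "(1 - r) * norm w < (1 - r) * (\<epsilon> * norm y)"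
    by (simp add: algebra_simps)
  then have w: "norm w < \<epsilon> * norm y"
    using r by simp
  have "A1 y - cnj l1 *\<^sub>C y = - (cnj l1 *\<^sub>C A1 w)"
  proof -
    have "cnj l1 * l1 = 1"
      using l(1) by (simp add: mult.commute flip: complex_norm_square)
    then show ?thesis
      by (simp add: w_def diffs scales AV scaleC_diff_right scaleC_scaleC scaleC_one)
  qed
  then have 1: "norm (A1 y - cnj l1 *\<^sub>C y) < \<epsilon> * norm y"
    using w l norm_adj_isometry_le[OF iso1, of w] by (simp add: norm_scaleC)
  have "A2 y - cnj l2 *\<^sub>C y = (- (complex_of_real (1 - r) * cnj l2)) *\<^sub>C y"
    by (simp add: A2y \<mu>_def scaleC_minus_left algebra_simps flip: scaleC_add_left)
  then have "norm (A2 y - cnj l2 *\<^sub>C y) = (1 - r) * cmod l2 * norm y"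
    using r by (simp add: norm_scaleC norm_mult del: of_real_diff)
  also have "\<dots> \<le> (1 - r) * norm y"
    using r l by (intro mult_right_mono) (auto simp: mult_left_le)
  also have "\<dots> < \<epsilon> * norm y"
    using r y0 by simp
  finally have 2: "norm (A2 y - cnj l2 *\<^sub>C y) < \<epsilon> * norm y" .
  define z where "z = complex_of_real (1 / norm y) *\<^sub>C y"
  have sc: "norm (A z - c *\<^sub>C z) < \<epsilon>" if "cblinear A" "norm (A y - c *\<^sub>C y) < \<epsilon> * norm y" for A c
  proof -
    have "A z - c *\<^sub>C z = complex_of_real (1 / norm y) *\<^sub>C (A y - c *\<^sub>C y)"
      by (simp add: z_def cblinear_scaleC[OF that(1)] scaleC_diff_right scaleC_scaleC mult.commute)
    then have "norm (A z - c *\<^sub>C z) = norm (A y - c *\<^sub>C y) / norm y"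
      by (simp add: norm_scaleC norm_divide)
    then show ?thesis
      using that(2) y0 by (simp add: pos_divide_less_eq)
  qed
  have "norm z = 1"
    using y0 by (simp add: z_def norm_scaleC norm_divide)
  then show ?thesis
    using sc[OF lin_adj(1) 1] sc[OF lin_adj(2) 2] by blast
qed

lemma not_koszul_exact_boundary1:
  assumes x: "x \<in> E" "x \<noteq> 0" and l: "cmod l1 = 1" "cmod l2 \<le> 1"
  shows "\<not> koszul_exact (\<lambda>x. V1 x - l1 *\<^sub>C x) (\<lambda>x. V2 x - l2 *\<^sub>C x)"
proof -
  have "koszul_breaks_at (\<lambda>x. V1 x - l1 *\<^sub>C x) (\<lambda>x. V2 x - l2 *\<^sub>C x) 3"
    using joint_approx_eigenvector[OF x l]
    by (intro koszul_breaks_at_3I) (simp_all add: cblinear_minus_scaleC lin adj_minus_scaleC)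
  then show ?thesis
    unfolding koszul_exact_def by blast
qed

theorem taylor_spectrum_eq:
  assumes x: "x \<in> E" "x \<noteq> 0"
  shows "taylor_spectrum V1 V2 = {(l1, l2). cmod l1 \<le> 1 \<and> cmod l2 \<le> 1}"
proof -
  have "\<not> koszul_exact (\<lambda>x. V1 x - l1 *\<^sub>C x) (\<lambda>x. V2 x - l2 *\<^sub>C x) \<longleftrightarrow> cmod l1 \<le> 1 \<and> cmod l2 \<le> 1" for l1 l2
  proof -
    let ?T1 = "\<lambda>x. V1 x - l1 *\<^sub>C x" and ?T2 = "\<lambda>x. V2 x - l2 *\<^sub>C x"
    have T: "cblinear ?T1" "cblinear ?T2"
      by (simp_all add: cblinear_minus_scaleC lin)
    have com: "?T1 (?T2 x) = ?T2 (?T1 x)" for x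
      by (simp add: diffs scales comm scaleC_diff_right scaleC_scaleC mult.commute)
    consider (inside) "cmod l1 < 1" "cmod l2 < 1" | (b1) "cmod l1 = 1" "cmod l2 \<le> 1"
      | (b2) "cmod l2 = 1" "cmod l1 \<le> 1" | (o1) "cmod l1 > 1" | (o2) "cmod l2 > 1"
      by linarith
    then show ?thesis
    proof cases
      case inside
      then have "koszul_breaks_at ?T1 ?T2 2"
        using koszul_breaks_at_2 x by blast
      then show ?thesis
        using inside unfolding koszul_exact_def by auto
    next
      case b1
      then show ?thesis
        using not_koszul_exact_boundary1[OF x] by auto
    next
      case b2
      then have "\<not> koszul_exact ?T2 ?T1"
        using nonpositive_defect.not_koszul_exact_boundary1[OF swap] x core_swap by blast
      then show ?thesis
        using b2 koszul_exact_swap[OF T] by auto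
    next
      case o1
      then show ?thesis
        using koszul_exact_commute[OF com isometry_minus_scaleC_bij[OF iso1 o1] T] by simp
    next
      case o2
      then show ?thesis
        using koszul_exact_swap[OF T(2,1) koszul_exact_commute[OF com[symmetric] isometry_minus_scaleC_bij[OF iso2 o2] T(2,1)]]
        by simp
    qed
  qed
  then show ?thesis
    unfolding taylor_spectrum_def by auto
qed

end

section \<open>Adjoints on reducing subspaces and bijectivity of the index map\<close>

lemma csubspace_orth: "csubspace (orth S)"
  by (simp add: csubspace_def orth_def cinner_add_right cinner_scaleC_right)

text \<open>\<open>adj_on\<close> is a choice determined only on \<open>S\<close>. There both
  candidates satisfy its specification, so their difference lies in \<open>S\<close> and is
  orthogonal to itself.\<close>

lemma adj_on_eq_adj:
  assumes T: "cblinear T" and S: "csubspace S" and inv: "\<And>y. y \<in> S \<Longrightarrow> adj T y \<in> S" and y: "y \<in> S"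
  shows "adj_on S T y = adj T y"
proof -
  let ?P = "\<lambda>A. (\<forall>y\<in>S. A y \<in> S) \<and> (\<forall>x\<in>S. \<forall>y\<in>S. cinner (T x) y = cinner x (A y))"
  have "?P (adj T)"
    using inv by (simp add: cinner_adj_right T)
  then have A: "?P (adj_on S T)"
    unfolding adj_on_def by (rule someI[of ?P])
  let ?d = "adj_on S T y - adj T y"
  have "?d \<in> S"
    using A y inv S by (simp add: csubspace_diff)
  then have "cinner ?d (adj_on S T y) = cinner ?d (adj T y)"
    using A y by (simp add: cinner_adj_right T)
  then have "cinner ?d ?d = 0"
    by (simp add: cinner_diff_right)
  then show ?thesis
    by (simp add: cinner_self_eq_0_iff)
qed

lemma inj_Umap: "inj Umap"
proof (rule injI)
  fix x y assume "Umap x = Umap y"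
  then show "x = y"
    by (cases x; cases y) (auto simp: Umap_def split: if_splits)
qed

text \<open>The three branches of \<open>Umap\<close> have images \<open>a \<ge> b + 2\<close>,
  \<open>a = b + 1\<close> and \<open>a \<le> b\<close>, which partition the index set.\<close>

lemma surj_Umap: "surj Umap"
proof -
  have "\<exists>m. n = Umap m" for n
  proof -
    obtain a b where n: "n = (a, b)" by force
    consider "a \<ge> b + 2" | "a = Suc b" | "a \<le> b" by linarith
    then show ?thesis
    proof cases
      case 1
      then have "n = Umap (a - 2, b)" by (auto simp: n Umap_def)
      then show ?thesis by blast
    next
      case 2
      then have "n = Umap (b, Suc b)" by (auto simp: n Umap_def)
      then show ?thesis by blast
    next
      case 3
      then have "n = Umap (a, b + 2)" by (auto simp: n Umap_def)
      then show ?thesis by blast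
    qed
  qed
  then show ?thesis by (simp add: surj_def)
qed

section \<open>Orthogonal sums of copies of a subspace\<close>

lemma has_sum_single:
  fixes f :: "'i \<Rightarrow> 'b::{comm_monoid_add, topological_space}"
  assumes "\<And>j. j \<noteq> i \<Longrightarrow> f j = 0"
  shows "(f has_sum f i) UNIV"
proof -
  have "(f has_sum f i) {i}"
    using has_sum_finite[of "{i}" f] by simp
  then show ?thesis
    by (rule has_sum_cong_neutral[THEN iffD1, rotated 3]) (use assms in auto)
qed

definition synthesis :: "(nat \<times> nat \<Rightarrow> 'a::chilbert_space \<Rightarrow> 'a) \<Rightarrow> (nat \<times> nat \<Rightarrow> 'a) \<Rightarrow> 'a" where
  "synthesis B c = infsum (\<lambda>m. B m (c m)) UNIV"

locale orthogonal_embeddings =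
  fixes E :: "'a::chilbert_space set" and B :: "nat \<times> nat \<Rightarrow> 'a \<Rightarrow> 'a"
  assumes E: "closed_csubspace E" and lin: "cblinear (B m)"
    and norm: "x \<in> E \<Longrightarrow> norm (B m x) = norm x"
    and orth: "x \<in> E \<Longrightarrow> y \<in> E \<Longrightarrow> m \<noteq> n \<Longrightarrow> cinner (B m x) (B n y) = 0"
begin

lemma subspace: "csubspace E"
  using E by (simp add: closed_csubspace_def)

lemma zero: "B m 0 = 0"
  by (simp add: cblinear_zero lin)

lemma cinner_embedding: "x \<in> E \<Longrightarrow> y \<in> E \<Longrightarrow> cinner (B m x) (B m y) = cinner x y"
  by (rule cinner_preserved_on_subspace[OF lin subspace norm])

lemma norm_sum_sq:
  assumes c: "\<And>m. c m \<in> E"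
  shows "finite F \<Longrightarrow> (norm (\<Sum>m\<in>F. B m (c m)))\<^sup>2 = (\<Sum>m\<in>F. (norm (c m))\<^sup>2)"
proof (induction F rule: finite_induct)
  case (insert m F)
  have "cinner (B m (c m)) (\<Sum>n\<in>F. B n (c n)) = 0"
    unfolding cinner_sum_right using insert.hyps orth c by (intro sum.neutral) metis
  then show ?case
    using insert by (simp add: norm_add_sq_orth norm c)
qed simp

lemma l2LD: "c \<in> l2L E \<Longrightarrow> c m \<in> E" "c \<in> l2L E \<Longrightarrow> (\<lambda>m. (norm (c m))\<^sup>2) summable_on UNIV"
  unfolding l2L_def by blast+

text \<open>Beyond a finite set, differences of partial sums have squared norm equal to a piece of
  the tail of the scalar series, so the partial sums form a Cauchy filter.\<close>

lemma summable:
  assumes c: "c \<in> l2L E"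
  shows "(\<lambda>m. B m (c m)) summable_on UNIV"
proof -
  let ?b = "\<lambda>F. \<Sum>m\<in>F. B m (c m)" and ?n = "\<lambda>F. \<Sum>m\<in>F. (norm (c m))\<^sup>2"
  define S where "S = l2_normsq c"
  have hs: "((\<lambda>m. (norm (c m))\<^sup>2) has_sum S) UNIV"
    unfolding S_def l2_normsq_def using l2LD[OF c] by simp
  have "\<exists>P. eventually P (finite_subsets_at_top UNIV) \<and>
      (\<forall>F F'. P F \<and> P F' \<longrightarrow> dist (?b F) (?b F') < e)" if e: "e > 0" for e :: real
  proof -
    have "eventually (\<lambda>F. dist (?n F) S < (e / 2)\<^sup>2) (finite_subsets_at_top UNIV)"
      using hs e unfolding has_sum_def by (intro tendstoD) auto
    then obtain F0 where F0: "finite F0" "\<And>F. finite F \<Longrightarrow> F0 \<subseteq> F \<Longrightarrow> dist (?n F) S < (e / 2)\<^sup>2"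
      unfolding eventually_finite_subsets_at_top by auto
    have near: "dist (?b F) (?b F0) < e / 2" if F: "finite F" "F0 \<subseteq> F" for F
    proof -
      have "(norm (?b F - ?b F0))\<^sup>2 = (norm (?b (F - F0)))\<^sup>2"
        using F F0(1) by (simp add: sum_diff)
      also have "\<dots> = ?n (F - F0)"
        using F by (intro norm_sum_sq l2LD[OF c]) auto
      also have "\<dots> = ?n F - ?n F0"
        using F F0(1) by (simp add: sum_diff)
      also have "\<dots> \<le> S - ?n F0"
        using finite_sum_le_has_sum[OF hs, of F] F by simp
      also have "\<dots> < (e / 2)\<^sup>2"
        using F0(2)[OF F0(1) order.refl] by (simp add: dist_real_def)
      finally show ?thesis
        unfolding dist_norm by (rule power2_less_imp_less) (use e in simp)
    qed
    have "dist (?b F) (?b F') < e" if "finite F \<and> F0 \<subseteq> F" "finite F' \<and> F0 \<subseteq> F'" for F F'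
      using near[of F] near[of F'] that dist_triangle2[of "?b F" "?b F'" "?b F0"] by linarith
    moreover have "eventually (\<lambda>F. finite F \<and> F0 \<subseteq> F) (finite_subsets_at_top UNIV)"
      using F0(1) unfolding eventually_finite_subsets_at_top by auto
    ultimately show ?thesis by blast
  qed
  then have "cauchy_filter (filtermap ?b (finite_subsets_at_top UNIV))"
    by (simp add: cauchy_filter_metric_filtermap)
  moreover have "complete (UNIV::'a set)"
    by (rule complete_UNIV)
  ultimately obtain L where "(?b \<longlongrightarrow> L) (finite_subsets_at_top UNIV)"
    using complete_uniform[where S = UNIV] by (force simp add: filterlim_def)
  then show ?thesis
    using summable_on_def has_sum_def by blast
qed

lemma has_sum_synthesis: "c \<in> l2L E \<Longrightarrow> ((\<lambda>m. B m (c m)) has_sum synthesis B c) UNIV"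
  unfolding synthesis_def using summable by simp

lemma norm_synthesis:
  assumes c: "c \<in> l2L E"
  shows "(norm (synthesis B c))\<^sup>2 = l2_normsq c"
proof (rule tendsto_unique)
  show "finite_subsets_at_top (UNIV :: (nat \<times> nat) set) \<noteq> bot"
    by simp
  have "((\<lambda>F. (norm (\<Sum>m\<in>F. B m (c m)))\<^sup>2) \<longlongrightarrow> (norm (synthesis B c))\<^sup>2) (finite_subsets_at_top UNIV)"
    using has_sum_synthesis[OF c] unfolding has_sum_def by (intro tendsto_intros)
  moreover have "eventually (\<lambda>F. (norm (\<Sum>m\<in>F. B m (c m)))\<^sup>2 = (\<Sum>m\<in>F. (norm (c m))\<^sup>2))
      (finite_subsets_at_top UNIV)"
    by (rule eventually_finite_subsets_at_top_weakI) (simp add: norm_sum_sq l2LD[OF c])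
  ultimately show "((\<lambda>F. \<Sum>m\<in>F. (norm (c m))\<^sup>2) \<longlongrightarrow> (norm (synthesis B c))\<^sup>2) (finite_subsets_at_top UNIV)"
    by (rule Lim_transform_eventually)
  show "((\<lambda>F. \<Sum>m\<in>F. (norm (c m))\<^sup>2) \<longlongrightarrow> l2_normsq c) (finite_subsets_at_top UNIV)"
    using l2LD(2)[OF c] unfolding l2_normsq_def by (simp flip: has_sum_def)
qed

text \<open>The parallelogram law provides the summable majorant \<open>?g\<close>.\<close>

lemma l2L_combination:
  assumes c: "c \<in> l2L E" and d: "d \<in> l2L E"
  shows "(\<lambda>m. a *\<^sub>C c m + d m) \<in> l2L E"
proof -
  let ?g = "\<lambda>m. 2 * (cmod a)\<^sup>2 * (norm (c m))\<^sup>2 + 2 * (norm (d m))\<^sup>2"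
  have "?g summable_on UNIV"
    by (intro summable_on_add summable_on_cmult_right l2LD(2) c d)
  moreover have "(norm (a *\<^sub>C c m + d m))\<^sup>2 \<le> ?g m" for m
  proof -
    have "(norm (a *\<^sub>C c m + d m))\<^sup>2 + (norm (a *\<^sub>C c m - d m))\<^sup>2 = ?g m"
      by (simp add: norm_add_sq norm_diff_sq norm_scaleC power_mult_distrib)
    then show ?thesis
      using zero_le_power2[of "norm (a *\<^sub>C c m - d m)"] by linarith
  qed
  ultimately have "(\<lambda>m. (norm (a *\<^sub>C c m + d m))\<^sup>2) summable_on UNIV"
    by (rule summable_on_comparison_test) auto
  then show ?thesis
    using l2LD(1)[OF c] l2LD(1)[OF d] subspace
    by (simp add: l2L_def csubspace_add csubspace_scaleC)
qed

lemma synthesis_combination: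
  assumes c: "c \<in> l2L E" and d: "d \<in> l2L E"
  shows "synthesis B (\<lambda>m. a *\<^sub>C c m + d m) = a *\<^sub>C synthesis B c + synthesis B d"
proof -
  have "((\<lambda>m. a *\<^sub>C B m (c m) + B m (d m)) has_sum (a *\<^sub>C synthesis B c + synthesis B d)) UNIV"
    by (intro has_sum_add has_sum_bounded_linear[OF bounded_linear_scaleC] has_sum_synthesis c d)
  then show ?thesis
    unfolding synthesis_def[of B "\<lambda>m. a *\<^sub>C c m + d m"]
    by (intro infsumI) (simp add: cblinear_add[OF lin] cblinear_scaleC[OF lin])
qed

lemma zero_l2L: "(\<lambda>_. 0) \<in> l2L E"
  using subspace by (simp add: l2L_def csubspace_def)

lemma csubspace_range: "csubspace (synthesis B ` l2L E)"
  unfolding csubspace_def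
proof (intro conjI ballI allI)
  have s0: "synthesis B (\<lambda>_. 0) = 0"
    by (simp add: synthesis_def zero)
  then show "0 \<in> synthesis B ` l2L E"
    using zero_l2L by (metis imageI)
  show "x + y \<in> synthesis B ` l2L E"
    if xy: "x \<in> synthesis B ` l2L E" "y \<in> synthesis B ` l2L E" for x y
  proof -
    obtain c d where cd: "c \<in> l2L E" "x = synthesis B c" "d \<in> l2L E" "y = synthesis B d"
      using xy by blast
    then have "x + y = synthesis B (\<lambda>m. 1 *\<^sub>C c m + d m)"
      using synthesis_combination[of c d 1] by (simp add: scaleC_one)
    then show ?thesis
      using l2L_combination cd by blast
  qed
  show "a *\<^sub>C x \<in> synthesis B ` l2L E" if x: "x \<in> synthesis B ` l2L E" for a x
  proof -
    obtain c where c: "c \<in> l2L E" "x = synthesis B c"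
      using x by blast
    then have "a *\<^sub>C x = synthesis B (\<lambda>m. a *\<^sub>C c m + 0)"
      using synthesis_combination[OF c(1) zero_l2L, of a] by (simp add: s0)
    then show ?thesis
      using l2L_combination[OF c(1) zero_l2L] by blast
  qed
qed

lemma embedding_in_range:
  assumes x: "x \<in> E"
  shows "B m x \<in> synthesis B ` l2L E"
proof -
  let ?c = "\<lambda>n. if n = m then x else 0"
  have "((\<lambda>n. (norm (?c n))\<^sup>2) has_sum (norm (?c m))\<^sup>2) UNIV"
    by (rule has_sum_single) simp
  then have c: "?c \<in> l2L E"
    using x subspace unfolding l2L_def summable_on_def by (auto simp: csubspace_def)
  have "((\<lambda>n. B n (?c n)) has_sum B m (?c m)) UNIV"
    by (rule has_sum_single) (simp add: zero)
  then have "synthesis B ?c = B m x"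
    unfolding synthesis_def by (simp add: infsumI)
  then show ?thesis
    using c by (metis imageI)
qed

lemma cinner_synthesis_embedding:
  assumes c: "c \<in> l2L E" and x: "x \<in> E"
  shows "cinner (synthesis B c) (B m x) = cinner (c m) x"
proof -
  have "((\<lambda>n. cinner (B n (c n)) (B m x)) has_sum cinner (synthesis B c) (B m x)) UNIV"
    by (intro has_sum_bounded_linear[OF bounded_linear_cinner_left] has_sum_synthesis c)
  moreover have "((\<lambda>n. cinner (B n (c n)) (B m x)) has_sum cinner (B m (c m)) (B m x)) UNIV"
    by (rule has_sum_single) (rule orth[OF l2LD(1)[OF c] x])
  ultimately show ?thesis
    using has_sum_unique cinner_embedding[OF l2LD(1)[OF c] x] by metis
qed

text \<open>By continuity of the inner product, orthogonality to the whole sum may be tested on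
  single copies of \<open>E\<close>.\<close>

lemma orth_rangeI:
  assumes "\<And>m x. x \<in> E \<Longrightarrow> cinner (B m x) y = 0"
  shows "y \<in> orth (synthesis B ` l2L E)"
proof -
  have "cinner (synthesis B c) y = 0" if c: "c \<in> l2L E" for c
  proof -
    have "((\<lambda>n. cinner (B n (c n)) y) has_sum cinner (synthesis B c) y) UNIV"
      by (intro has_sum_bounded_linear[OF bounded_linear_cinner_left] has_sum_synthesis c)
    then have "((\<lambda>n. 0) has_sum cinner (synthesis B c) y) (UNIV :: (nat \<times> nat) set)"
      by (simp add: assms l2LD(1)[OF c])
    then show ?thesis
      by (rule has_sum_unique) simp
  qed
  then show ?thesis
    by (auto simp: orth_def)
qed

text \<open>\<open>c m\<close> is the projection of \<open>adj (B m) x\<close> onto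
  \<open>E\<close>; Bessel's inequality makes the family square summable.\<close>

lemma coefficients_exist:
  obtains c where "c \<in> l2L E" "\<And>m e. e \<in> E \<Longrightarrow> cinner x (B m e) = cinner (c m) e"
proof -
  have "\<exists>p\<in>E. \<forall>e\<in>E. cinner x (B m e) = cinner p e" for m
  proof -
    obtain p where p: "p \<in> E" "\<And>e. e \<in> E \<Longrightarrow> cinner (adj (B m) x - p) e = 0"
      using orthogonal_projection_exists[OF E] by blast
    then have "cinner x (B m e) = cinner p e" if "e \<in> E" for e
      using p(2)[OF that] by (simp add: cinner_diff_left cinner_adj_left lin)
    with p(1) show ?thesis by blast
  qed
  then obtain c where c: "\<And>m. c m \<in> E" "\<And>m e. e \<in> E \<Longrightarrow> cinner x (B m e) = cinner (c m) e"
    by metis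
  have bessel: "(\<Sum>m\<in>F. (norm (c m))\<^sup>2) \<le> (norm x)\<^sup>2" if "finite F" for F
  proof -
    let ?s = "\<Sum>m\<in>F. B m (c m)"
    have "(norm ?s)\<^sup>2 = (\<Sum>m\<in>F. (norm (c m))\<^sup>2)"
      by (rule norm_sum_sq[OF c(1) that])
    moreover have "cinner x ?s = complex_of_real (\<Sum>m\<in>F. (norm (c m))\<^sup>2)"
      by (simp add: cinner_sum_right c cinner_self_norm)
    ultimately have "(norm (x - ?s))\<^sup>2 = (norm x)\<^sup>2 - (\<Sum>m\<in>F. (norm (c m))\<^sup>2)"
      by (simp only: norm_diff_sq) simp
    then show ?thesis
      using zero_le_power2[of "norm (x - ?s)"] by linarith
  qed
  have "(\<lambda>m. (norm (c m))\<^sup>2) summable_on UNIV"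
    by (rule nonneg_bdd_above_summable_on) (auto intro!: bdd_aboveI2 bessel)
  with c show thesis
    using that[of c] by (simp add: l2L_def)
qed

text \<open>Subtracting from a limit point the synthesis of its coefficients leaves a vector both in
  the closure and orthogonal to it, hence zero.\<close>

lemma closed_csubspace_range: "closed_csubspace (synthesis B ` l2L E)"
proof -
  let ?H = "synthesis B ` l2L E"
  have "x \<in> ?H" if x: "x \<in> closure ?H" for x
  proof -
    obtain c where c: "c \<in> l2L E" "\<And>m e. e \<in> E \<Longrightarrow> cinner x (B m e) = cinner (c m) e"
      using coefficients_exist by blast
    define y where "y = x - synthesis B c"
    have "cinner y (B m e) = 0" if "e \<in> E" for m e
      using c that by (simp add: y_def cinner_diff_left cinner_synthesis_embedding)
    then have "y \<in> orth ?H"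
      using cinner_commute_zero by (intro orth_rangeI) blast
    moreover have "synthesis B c \<in> closure ?H"
      using closure_subset c(1) by (meson imageI subsetD)
    then have "y \<in> closure ?H"
      unfolding y_def by (rule csubspace_diff[OF csubspace_closure[OF csubspace_range] x])
    ultimately have "cinner y y = 0"
      using orth_closure[of ?H y y] unfolding orth_def by blast
    then have "x = synthesis B c"
      by (simp add: cinner_self_eq_0_iff y_def)
    with c(1) show ?thesis by blast
  qed
  then have "closed ?H"
    using closure_subset_eq by blast
  then show ?thesis
    by (simp add: closed_csubspace_def csubspace_range)
qed

text \<open>Reindex the image series along \<open>s\<close> and extend it by zero; \<open>d\<close>
  is the shifted coefficient family.\<close>

lemma intertwine:
  assumes T: "cblinear T" and c: "c \<in> l2L E" and s: "inj s"
    and TB: "\<And>m x. x \<in> E \<Longrightarrow> T (B m x) = B (s m) x"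
    and d: "\<And>m. d (s m) = c m" "\<And>n. n \<notin> range s \<Longrightarrow> d n = 0"
  shows "T (synthesis B c) = synthesis B d"
proof -
  have "((\<lambda>m. T (B m (c m))) has_sum T (synthesis B c)) UNIV"
    by (intro has_sum_bounded_linear[OF cblinear_imp_bounded_linear[OF T]] has_sum_synthesis c)
  then have "((\<lambda>n. B n (d n)) \<circ> s has_sum T (synthesis B c)) UNIV"
    by (simp add: TB l2LD(1)[OF c] d comp_def)
  then have "((\<lambda>n. B n (d n)) has_sum T (synthesis B c)) (range s)"
    by (simp add: has_sum_reindex s)
  then have "((\<lambda>n. B n (d n)) has_sum T (synthesis B c)) UNIV"
    by (rule has_sum_cong_neutral[THEN iffD1, rotated 3]) (auto simp: d zero)
  then show ?thesis
    unfolding synthesis_def[of B d] by (simp add: infsumI)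
qed

lemma orth_range_invariant:
  assumes T: "cblinear T" and adj: "\<And>m x. x \<in> E \<Longrightarrow> adj T (B m x) \<in> synthesis B ` l2L E"
    and y: "y \<in> orth (synthesis B ` l2L E)"
  shows "T y \<in> orth (synthesis B ` l2L E)"
proof (rule orth_rangeI)
  fix m x assume "x \<in> E"
  then have "cinner (adj T (B m x)) y = 0"
    using adj y unfolding orth_def by blast
  then show "cinner (B m x) (T y) = 0"
    by (simp add: cinner_adj_left T)
qed

lemma orth_range_adj_invariant:
  assumes T: "cblinear T" and inv: "\<And>m x. x \<in> E \<Longrightarrow> T (B m x) \<in> synthesis B ` l2L E"
    and y: "y \<in> orth (synthesis B ` l2L E)"
  shows "adj T y \<in> orth (synthesis B ` l2L E)"
proof (rule orth_rangeI)
  fix m x assume "x \<in> E"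
  then have "cinner (T (B m x)) y = 0"
    using inv y unfolding orth_def by blast
  then show "cinner (B m x) (adj T y) = 0"
    by (simp add: cinner_adj_right T)
qed

end

section \<open>The model summand\<close>

lemma tau2_op_shift: "tau2_op c (fst (Umap m), Suc (snd (Umap m))) = c m"
  by (simp add: tau2_op_def Mz2_op_def U_op_def inj_Umap)

lemma tau2_op_boundary: "tau2_op c (n, 0) = 0"
  by (simp add: tau2_op_def Mz2_op_def)

lemma tau1_op_shift: "Umap n = (Suc (fst m), snd m) \<Longrightarrow> tau1_op c n = c m"
  by (simp add: tau1_op_def Ustar_op_def Mz1_op_def)

lemma tau1_op_boundary: "fst (Umap n) = 0 \<Longrightarrow> tau1_op c n = 0"
  by (simp add: tau1_op_def Ustar_op_def Mz1_op_def case_prod_beta)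

context nonpositive_defect
begin

sublocale cells: orthogonal_embeddings E "cell V1 V2"
  by unfold_locales (simp_all add: closed_csubspace_core cblinear_cell norm_cell cell_orth)

abbreviation "H0 \<equiv> synthesis (cell V1 V2) ` l2L E"

section \<open>Action on the model and reduction of the pair\<close>

lemma V1_synthesis:
  assumes c: "c \<in> l2L E"
  shows "V1 (synthesis (cell V1 V2) c) = synthesis (cell V1 V2) (tau1_op c)"
proof -
  \<comment> \<open>The index map of \<open>tau1\<close>: a shift of the first entry followed by the
    inverse of \<open>Umap\<close>, as in \<open>U\<^sup>* M\<close>.\<close>
  define s where "s m = inv Umap (Suc (fst m), snd m)" for m
  have Us: "Umap (s m) = (Suc (fst m), snd m)" for m
    by (simp add: s_def surj_f_inv_f surj_Umap)
  have "inj s"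
    by (rule injI) (metis Us Pair_inject Suc_inject prod_eq_iff)
  moreover have "V1 (cell V1 V2 m x) = cell V1 V2 (s m) x" if "x \<in> E" for m x
    using V1_cell[OF that Us] by simp
  moreover have "tau1_op c n = 0" if n: "n \<notin> range s" for n
  proof (rule tau1_op_boundary, rule ccontr)
    assume "fst (Umap n) \<noteq> 0"
    then obtain p where "Umap n = (Suc p, snd (Umap n))"
      by (metis not0_implies_Suc prod.collapse)
    then have "Umap n = Umap (s (p, snd (Umap n)))"
      by (simp add: Us)
    then show False
      using n inj_Umap by (metis injD rangeI)
  qed
  ultimately show ?thesis
    using c tau1_op_shift[OF Us] by (intro cells.intertwine[of _ _ s]) (auto simp: lin)
qed

lemma V2_synthesis:
  assumes c: "c \<in> l2L E"
  shows "V2 (synthesis (cell V1 V2) c) = synthesis (cell V1 V2) (tau2_op c)"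
proof -
  define s where "s m = (fst (Umap m), Suc (snd (Umap m)))" for m
  have "inj s"
    by (rule injI) (metis Pair_inject Suc_inject inj_Umap injD prod_eqI s_def)
  moreover have "tau2_op c n = 0" if n: "n \<notin> range s" for n
  proof -
    \<comment> \<open>Since \<open>Umap\<close> is onto, every index above the bottom row is in the
      range of \<open>s\<close>.\<close>
    have "snd n = 0"
    proof (rule ccontr)
      assume "snd n \<noteq> 0"
      then obtain q where q: "n = (fst n, Suc q)"
        by (metis not0_implies_Suc prod.collapse)
      obtain m where "(fst n, q) = Umap m"
        using surj_Umap by (metis surjD)
      then have "n = s m"
        using q by (simp add: s_def flip: \<open>(fst n, q) = Umap m\<close>)
      with n show False by blast
    qed
    then show ?thesis
      using tau2_op_boundary by (metis prod.collapse)
  qed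
  ultimately show ?thesis
    using c by (intro cells.intertwine[of _ _ s]) (auto simp: lin s_def V2_cell tau2_op_shift)
qed

text \<open>A cell is either killed by \<open>A1\<close> or the \<open>V1\<close>-image of another
  cell, which \<open>A1\<close> restores. By duality this makes \<open>orth H0\<close> invariant
  under \<open>V1\<close>.\<close>

lemma A1_cell_in_H0:
  assumes x: "x \<in> E"
  shows "A1 (cell V1 V2 n x) \<in> H0"
proof (cases "fst (Umap n)")
  case 0
  then show ?thesis
    using A1_cell_boundary[OF x] cells.csubspace_range by (simp add: csubspace_def)
next
  case (Suc p)
  then have "V1 (cell V1 V2 (p, snd (Umap n)) x) = cell V1 V2 n x"
    by (intro V1_cell[OF x]) (metis prod.collapse)
  then have "A1 (cell V1 V2 n x) = cell V1 V2 (p, snd (Umap n)) x"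
    by (metis AV(1))
  then show ?thesis
    using cells.embedding_in_range[OF x] by simp
qed

lemma A2_cell_in_H0:
  assumes x: "x \<in> E"
  shows "A2 (cell V1 V2 n x) \<in> H0"
proof (cases "snd n")
  case 0
  then show ?thesis
    using A2_cell_boundary[OF x, of "fst n"] cells.csubspace_range
    by (metis csubspace_def prod.collapse)
next
  case (Suc q)
  obtain m where m: "(fst n, q) = Umap m"
    using surj_Umap by (metis surjD)
  have "V2 (cell V1 V2 m x) = cell V1 V2 n x"
    using V2_cell[OF x, of m] Suc by (simp flip: m) (metis prod.collapse)
  then have "A2 (cell V1 V2 n x) = cell V1 V2 m x"
    by (metis AV(2))
  then show ?thesis
    using cells.embedding_in_range[OF x] by simp
qed

lemma V1_cell_in_H0:
  assumes x: "x \<in> E"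
  shows "V1 (cell V1 V2 m x) \<in> H0"
proof -
  obtain n where "Umap n = (Suc (fst m), snd m)"
    using surj_Umap by (metis surjD)
  then show ?thesis
    using V1_cell[OF x, of n "fst m" "snd m"] cells.embedding_in_range[OF x] by simp
qed

lemma V2_cell_in_H0: "x \<in> E \<Longrightarrow> V2 (cell V1 V2 m x) \<in> H0"
  by (simp add: V2_cell cells.embedding_in_range)

lemma V_orth_H0:
  assumes y: "y \<in> orth H0"
  shows "V1 y \<in> orth H0" "V2 y \<in> orth H0"
  using cells.orth_range_invariant[OF lin(1) A1_cell_in_H0 y]
    cells.orth_range_invariant[OF lin(2) A2_cell_in_H0 y] by blast+

lemma adj_orth_H0:
  assumes y: "y \<in> orth H0"
  shows "A1 y \<in> orth H0" "A2 y \<in> orth H0"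
  using cells.orth_range_adj_invariant[OF lin(1) V1_cell_in_H0 y]
    cells.orth_range_adj_invariant[OF lin(2) V2_cell_in_H0 y] by blast+

lemma core_subset_H0: "E \<subseteq> H0"
proof
  fix x assume x: "x \<in> E"
  then show "x \<in> H0"
    using cells.embedding_in_range[OF x, of "(0, 1)"] by (simp add: cell_def)
qed

text \<open>As \<open>orth H0\<close> is invariant under the adjoints, its intrinsic defect is the
  restriction of the full one, which vanishes because \<open>H0\<close> contains the core.\<close>

lemma defect_on_orth_H0:
  assumes x: "x \<in> orth H0"
  shows "defect_on (orth H0) V1 V2 x = 0"
proof -
  have "adj_on (orth H0) V1 y = A1 y" "adj_on (orth H0) V2 y = A2 y" if "y \<in> orth H0" for y
    using adj_on_eq_adj[OF lin(1) csubspace_orth adj_orth_H0(1) that]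
      adj_on_eq_adj[OF lin(2) csubspace_orth adj_orth_H0(2) that] by blast+
  then have "defect_on (orth H0) V1 V2 x = defect V1 V2 x"
    using x adj_orth_H0(1)[OF x] by (simp add: defect_on_def defect_def)
  also have "x \<in> orth E"
    using x core_subset_H0 by (auto simp: orth_def)
  then have "defect V1 V2 x = 0"
    by (rule defect_orth_core)
  finally show ?thesis .
qed

text \<open>\<open>A1 x\<close> witnesses strictness: it is killed by the adjoint of the product,
  but if it were in the core, then \<open>A1 x = V2 (A2 (A1 x)) = 0\<close> and so
  \<open>x = 0\<close>.\<close>

lemma core_psubset_kernel:
  assumes x: "x \<in> E" "x \<noteq> 0"
  shows "E \<subset> {x. adj (\<lambda>y. V1 (V2 y)) x = 0}"
proof -
  have adjV: "adj (\<lambda>y. V1 (V2 y)) y = A2 (A1 y)" for y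
    by (rule adj_compose[OF lin])
  have "A1 x \<notin> E"
  proof
    assume "A1 x \<in> E"
    then have "A1 x = 0"
      using coreD(2)[of "A1 x"] coreD(4)[OF x(1)] by (simp add: zeros)
    then show False
      using coreD(1)[OF x(1)] x(2) by (simp add: zeros)
  qed
  moreover have "A2 (A1 (A1 x)) = 0"
    using coreD(4)[OF x(1)] by (simp add: zeros flip: adj_comm)
  ultimately show ?thesis
    unfolding adjV using coreD(4) by blast
qed

lemma same_hilbert_dim_core: "same_hilbert_dim E (closure (range (defect V1 V2)))"
proof -
  have "closure (range (defect V1 V2)) = E"
    using closed_csubspace_core by (simp add: range_defect closed_csubspace_def)
  moreover obtain F where "orthonormal_basis_of F E"
    using orthonormal_basis_exists[OF closed_csubspace_core] by blast
  ultimately show ?thesis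
    unfolding same_hilbert_dim_def using bij_betw_id by metis
qed

end

theorem theorem3p10:
  fixes V1 V2 :: "'a::chilbert_space \<Rightarrow> 'a"
  assumes iso1: "isometry V1" and iso2: "isometry V2"
    and comm: "\<forall>x. V1 (V2 x) = V2 (V1 x)"
    and Cle0: "\<forall>x. Im (cinner (defect V1 V2 x) x) = 0 \<and> Re (cinner (defect V1 V2 x) x) \<le> 0"
    and Cne0: "\<exists>x. defect V1 V2 x \<noteq> 0"
  shows "(\<exists>L H0 \<Phi>.
           closed_csubspace L \<and> L \<noteq> {0} \<and> L \<subset> {x. adj (\<lambda>y. V1 (V2 y)) x = 0}
         \<and> same_hilbert_dim L (closure (range (defect V1 V2)))
         \<and> closed_csubspace H0
         \<and> (\<forall>c\<in>l2L L. \<forall>d\<in>l2L L. \<forall>a. \<Phi> (\<lambda>m. a *\<^sub>C c m + d m) = a *\<^sub>C \<Phi> c + \<Phi> d)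
         \<and> (\<forall>c\<in>l2L L. (norm (\<Phi> c))\<^sup>2 = l2_normsq c)
         \<and> \<Phi> ` l2L L = H0
         \<and> (\<forall>c\<in>l2L L. V1 (\<Phi> c) = \<Phi> (tau1_op c) \<and> V2 (\<Phi> c) = \<Phi> (tau2_op c))
         \<and> (\<forall>x\<in>orth H0. V1 x \<in> orth H0 \<and> V2 x \<in> orth H0)
         \<and> (\<forall>x\<in>orth H0. defect_on (orth H0) V1 V2 x = 0))
       \<and> taylor_spectrum V1 V2 = {(l1, l2). cmod l1 \<le> 1 \<and> cmod l2 \<le> 1}
       \<and> (\<forall>l1 l2. cmod l1 < 1 \<and> cmod l2 < 1 \<longrightarrow>
            koszul_breaks_at (\<lambda>x. V1 x - l1 *\<^sub>C x) (\<lambda>x. V2 x - l2 *\<^sub>C x) 2)"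
proof -
  interpret nonpositive_defect V1 V2
    using assms by unfold_locales auto
  obtain x where x: "x \<in> E" "x \<noteq> 0"
    using Cne0 defect_in_core by blast
  show ?thesis
  proof (intro conjI allI impI)
    show "\<exists>L H0 \<Phi>.
           closed_csubspace L \<and> L \<noteq> {0} \<and> L \<subset> {x. adj (\<lambda>y. V1 (V2 y)) x = 0}
         \<and> same_hilbert_dim L (closure (range (defect V1 V2)))
         \<and> closed_csubspace H0
         \<and> (\<forall>c\<in>l2L L. \<forall>d\<in>l2L L. \<forall>a. \<Phi> (\<lambda>m. a *\<^sub>C c m + d m) = a *\<^sub>C \<Phi> c + \<Phi> d)
         \<and> (\<forall>c\<in>l2L L. (norm (\<Phi> c))\<^sup>2 = l2_normsq c)
         \<and> \<Phi> ` l2L L = H0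
         \<and> (\<forall>c\<in>l2L L. V1 (\<Phi> c) = \<Phi> (tau1_op c) \<and> V2 (\<Phi> c) = \<Phi> (tau2_op c))
         \<and> (\<forall>x\<in>orth H0. V1 x \<in> orth H0 \<and> V2 x \<in> orth H0)
         \<and> (\<forall>x\<in>orth H0. defect_on (orth H0) V1 V2 x = 0)"
    \<comment> \<open>The core serves as multiplicity space \<open>L\<close>, and
      \<open>\<Phi>\<close> sums the cells.\<close>
    proof (rule exI[of _ E], rule exI[of _ H0], rule exI[of _ "synthesis (cell V1 V2)"], intro conjI ballI allI)
      show "E \<noteq> {0}"
        using x by blast
    qed (simp_all add: closed_csubspace_core core_psubset_kernel[OF x] same_hilbert_dim_core
        cells.closed_csubspace_range cells.synthesis_combination cells.norm_synthesis
        V1_synthesis V2_synthesis V_orth_H0 defect_on_orth_H0)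
    show "taylor_spectrum V1 V2 = {(l1, l2). cmod l1 \<le> 1 \<and> cmod l2 \<le> 1}"
      by (rule taylor_spectrum_eq[OF x])
    show "koszul_breaks_at (\<lambda>x. V1 x - l1 *\<^sub>C x) (\<lambda>x. V2 x - l2 *\<^sub>C x) 2"
      if "cmod l1 < 1 \<and> cmod l2 < 1" for l1 l2
      using koszul_breaks_at_2[OF x] that by blast
  qed
qed

end
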